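(* Let $p>2$ be a prime and $n\geq 1$. The maximal cells of the fan $H_{p,n}\subseteq\mathbb{R}^{n+1}$ are exactly the following (closures of sets of tropical polynomials $f=\bigoplus_{r=0}^n a_rx^r$): (Type I, denoted $\{i,j,k\}$) the polynomials where the minimum of the coefficients $a_r$ is attained at three different monomials $i,j,k$ having three different residues modulo $p$; (Type II, denoted $[\{i,j\},\{k,l\}]$) the polynomials where the minimum of the coefficients is attained at two monomials $i\neq j$ with $i\equiv j\pmod p$, and such that, after eliminating all monomials $r$ with $r\equiv i\pmod p$, the minimum of the remaining coefficients is attained at $k,l$ with $k\not\equiv l\pmod p$; (Type III, denoted $\{\{i,j\},\{k,l\}\}$) the polynomials where the minimum of the coefficients is attained at two monomials $i\neq j$ with $i\equiv j\pmod p$, and such that, after eliminating all monomials $r$ with $r\equiv i\pmod p$, the minimum of the remaining coefficients is attained at $k\neq l$ with $k\equiv l\pmod p$.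
   Context: $\mathbb{K}$ is an algebraically closed field with a nontrivial valuation $v:\mathbb{K}^*\to\mathbb{T}$, $\mathbb{Q}\subseteq\mathbb{T}\subseteq\mathbb{R}$ an additive subgroup; characteristic $p$ means both $\mathbb{K}$ and its residue field have characteristic $p$. A tropical polynomial of degree $n$ is $f=\bigoplus_{r=0}^n a_rx^r$, identified with $(a_0,\ldots,a_n)\in\mathbb{R}^{n+1}$; the index $r$ is called a monomial of $f$. For $f\in\mathbb{T}^{n+1}$, $0$ is a tropical double root of $f$ if there are $F=\sum_rA_rX^r\in\mathbb{K}[X]$ with $v(A_r)=a_r$ and $B\in\mathbb{K}^*$ with $v(B)=0$ that is a multiple root of $F$. $H_{p,n}\subseteq\mathbb{R}^{n+1}$ is the (closure of the) set of tropical polynomials of degree $n$ having $0$ as tropical double root in characteristic $p$; it is a tropical linear space and a polyhedral fan. Equivalently, $f\in H_{p,n}$ iff for every $s=0,\ldots,p-1$ the minimum of $\{a_r : r\not\equiv s \bmod p\}$ is attained at least twice, and the minimum of all $a_r$ is attained at least twice. *)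

theory Defs
  imports "HOL-Analysis.Analysis" "HOL-Computational_Algebra.Polynomial" "HOL-Number_Theory.Cong"
begin

section \<open>Valued fields\<close>

text \<open>
  A nontrivial valuation \<open>v : K\<^sup>* \<rightarrow> T\<close>, with \<open>\<rat> \<subseteq> T \<subseteq> \<real>\<close> an additive subgroup. The value of \<open>v\<close> at \<open>0\<close>
  is irrelevant, and \<open>v\<close> is not required to be onto \<open>T\<close>.
\<close>

definition valuation_into :: "('k::field \<Rightarrow> real) \<Rightarrow> real set \<Rightarrow> bool" where
  "valuation_into v T \<longleftrightarrow>
     \<rat> \<subseteq> T \<and> (\<forall>s\<in>T. \<forall>t\<in>T. s + t \<in> T) \<and> (\<forall>t\<in>T. - t \<in> T) \<and>
     (\<forall>x. x \<noteq> 0 \<longrightarrow> v x \<in> T) \<and>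
     (\<forall>x y. x \<noteq> 0 \<longrightarrow> y \<noteq> 0 \<longrightarrow> v (x * y) = v x + v y) \<and>
     (\<forall>x y. x \<noteq> 0 \<longrightarrow> y \<noteq> 0 \<longrightarrow> x + y \<noteq> 0 \<longrightarrow> min (v x) (v y) \<le> v (x + y)) \<and>
     (\<exists>x. x \<noteq> 0 \<and> v x \<noteq> 0)"

text \<open>
  If \<open>K\<close> has prime characteristic \<open>p\<close>, then so has the residue field: a natural number lies in
  the maximal ideal of the valuation ring iff it is divisible by \<open>p\<close>.
\<close>

lemma residue_char_eq:
  fixes v :: "'k::field \<Rightarrow> real"
  assumes val: "valuation_into v T" and char: "CHAR('k) = p" and p: "prime p"
  shows "((of_nat m :: 'k) = 0 \<or> v (of_nat m) > 0) \<longleftrightarrow> p dvd m"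
proof -
  have mult: "v (x * y) = v x + v y" if "x \<noteq> 0" "y \<noteq> 0" for x y
    using val that unfolding valuation_into_def by blast
  have add: "min (v x) (v y) \<le> v (x + y)" if "x \<noteq> 0" "y \<noteq> 0" "x + y \<noteq> 0" for x y
    using val that unfolding valuation_into_def by blast
  have one: "v 1 = 0"
    using mult[of 1 1] by simp
  have nonneg: "v (of_nat k) \<ge> 0" if "(of_nat k :: 'k) \<noteq> 0" for k
    using that
  proof (induction k)
    case (Suc k)
    show ?case
    proof (cases "(of_nat k :: 'k) = 0")
      case True
      then show ?thesis by (simp add: one)
    next
      case False
      with Suc add[of 1 "of_nat k"] show ?thesis by (simp add: one)
    qed
  qed simp
  have "v (of_nat m) = 0" if "\<not> p dvd m"
  proof -
    have "coprime m p"
      using that p prime_imp_coprime coprime_commute by blast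
    then obtain k where "[m * k = 1] (mod p)"
      using cong_solve_coprime_nat by auto
    then have eq: "(of_nat m * of_nat k :: 'k) = 1"
      using of_nat_eq_iff_cong_CHAR[where 'a = 'k, of "m * k" 1] char by simp
    then have nz: "(of_nat m :: 'k) \<noteq> 0" "(of_nat k :: 'k) \<noteq> 0"
      by auto
    have "v (of_nat m) + v (of_nat k) = 0"
      using mult[OF nz] eq one by simp
    with nonneg[OF nz(1)] nonneg[OF nz(2)] show ?thesis by simp
  qed
  then show ?thesis
    using char of_nat_eq_0_iff_char_dvd[where 'a = 'k, of m] by fastforce
qed

section \<open>The tropical linear space \<open>H\<close>\<close>

text \<open>
  \<open>\<real>\<^bsup>n+1\<^esup>\<close> is \<open>real ^ 'm\<close> together with a bijection \<open>idx\<close> from the monomials \<open>{0..n}\<close> to the index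
  type \<open>'m\<close>; thus \<open>f $ idx r\<close> is the coefficient \<open>a\<^sub>r\<close> of the tropical polynomial \<open>f\<close>.
\<close>

definition tropical_double_root_0 ::
    "('k::field \<Rightarrow> real) \<Rightarrow> nat \<Rightarrow> (nat \<Rightarrow> 'm::finite) \<Rightarrow> real ^ 'm \<Rightarrow> bool" where
  "tropical_double_root_0 v n idx f \<longleftrightarrow>
     (\<exists>F :: 'k poly. degree F = n \<and>
        (\<forall>r\<in>{0..n}. coeff F r \<noteq> 0 \<and> v (coeff F r) = f $ idx r) \<and>
        (\<exists>B. B \<noteq> 0 \<and> v B = 0 \<and> order B F \<ge> 2))"

text \<open>The characteristic is that of the field \<open>'k\<close> on which \<open>v\<close> is defined.\<close>

definition H_space ::
    "('k::field \<Rightarrow> real) \<Rightarrow> real set \<Rightarrow> nat \<Rightarrow> (nat \<Rightarrow> 'm::finite) \<Rightarrow> (real ^ 'm) set" where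
  "H_space v T n idx =
     closure {f. (\<forall>r\<in>{0..n}. f $ idx r \<in> T) \<and> tropical_double_root_0 v n idx f}"

section \<open>Polyhedral fans\<close>

text \<open>The side conditions \<open>\<noteq> {}\<close> are needed because the empty set is a cone and a face in the library.\<close>

definition polyhedral_fan :: "'a::euclidean_space set set \<Rightarrow> bool" where
  "polyhedral_fan \<Sigma> \<longleftrightarrow>
     finite \<Sigma> \<and>
     (\<forall>\<sigma>\<in>\<Sigma>. polyhedron \<sigma> \<and> cone \<sigma> \<and> \<sigma> \<noteq> {}) \<and>
     (\<forall>\<sigma>\<in>\<Sigma>. \<forall>\<tau>. \<tau> face_of \<sigma> \<and> \<tau> \<noteq> {} \<longrightarrow> \<tau> \<in> \<Sigma>) \<and>
     (\<forall>\<sigma>\<in>\<Sigma>. \<forall>\<tau>\<in>\<Sigma>. (\<sigma> \<inter> \<tau>) face_of \<sigma> \<and> (\<sigma> \<inter> \<tau>) face_of \<tau>)"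

text \<open>
  A set that is the support of a fan supports many fans; when it is called a fan, the coarsest
  one is meant. There is at most one.
\<close>

definition coarsest_fan_on :: "'a::euclidean_space set \<Rightarrow> 'a set set \<Rightarrow> bool" where
  "coarsest_fan_on S \<Sigma> \<longleftrightarrow>
     polyhedral_fan \<Sigma> \<and> \<Union>\<Sigma> = S \<and>
     (\<forall>\<Sigma>'. polyhedral_fan \<Sigma>' \<and> \<Union>\<Sigma>' = S \<longrightarrow> (\<forall>\<sigma>'\<in>\<Sigma>'. \<exists>\<sigma>\<in>\<Sigma>. \<sigma>' \<subseteq> \<sigma>))"

definition maximal_cells :: "'a set set \<Rightarrow> 'a set set" where
  "maximal_cells \<Sigma> = {\<sigma>\<in>\<Sigma>. \<forall>\<tau>\<in>\<Sigma>. \<sigma> \<subseteq> \<tau> \<longrightarrow> \<tau> = \<sigma>}"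

lemma coarsest_fan_on_refines:
  assumes "coarsest_fan_on S \<Sigma>" "polyhedral_fan \<Sigma>'" "\<Union>\<Sigma>' = S" "\<sigma>' \<in> \<Sigma>'"
  shows "\<exists>\<sigma>\<in>\<Sigma>. \<sigma>' \<subseteq> \<sigma>"
proof -
  have "\<forall>\<Sigma>'. polyhedral_fan \<Sigma>' \<and> \<Union>\<Sigma>' = S \<longrightarrow> (\<forall>\<sigma>'\<in>\<Sigma>'. \<exists>\<sigma>\<in>\<Sigma>. \<sigma>' \<subseteq> \<sigma>)"
    using assms(1) unfolding coarsest_fan_on_def by (elim conjE)
  from this[rule_format, of \<Sigma>' \<sigma>'] assms(2-) show ?thesis by (simp only: simp_thms)
qed

lemma coarsest_fan_on_subset:
  assumes "coarsest_fan_on S \<Sigma>" "coarsest_fan_on S \<Sigma>'"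
  shows "\<Sigma> \<subseteq> \<Sigma>'"
proof
  fix \<sigma> assume \<sigma>: "\<sigma> \<in> \<Sigma>"
  have fan: "polyhedral_fan \<Sigma>" "polyhedral_fan \<Sigma>'"
    using assms unfolding coarsest_fan_on_def by auto
  then obtain \<mu> where \<mu>: "\<mu> \<in> \<Sigma>" "\<sigma> \<subseteq> \<mu>" "\<And>\<tau>. \<tau> \<in> \<Sigma> \<Longrightarrow> \<mu> \<subseteq> \<tau> \<Longrightarrow> \<mu> = \<tau>"
    using finite_has_maximal2[of \<Sigma> \<sigma>] \<sigma> unfolding polyhedral_fan_def by metis
  have supp: "\<Union>\<Sigma> = S" "\<Union>\<Sigma>' = S"
    using assms unfolding coarsest_fan_on_def by auto
  have refine: "\<And>\<sigma>. \<sigma> \<in> \<Sigma> \<Longrightarrow> \<exists>\<tau>\<in>\<Sigma>'. \<sigma> \<subseteq> \<tau>" "\<And>\<tau>. \<tau> \<in> \<Sigma>' \<Longrightarrow> \<exists>\<sigma>\<in>\<Sigma>. \<tau> \<subseteq> \<sigma>"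
    using coarsest_fan_on_refines[OF assms(2) fan(1) supp(1)]
      coarsest_fan_on_refines[OF assms(1) fan(2) supp(2)] by blast+
  obtain \<tau> where \<tau>: "\<tau> \<in> \<Sigma>'" "\<mu> \<subseteq> \<tau>"
    using refine(1)[OF \<mu>(1)] by blast
  obtain \<mu>' where \<mu>': "\<mu>' \<in> \<Sigma>" "\<tau> \<subseteq> \<mu>'"
    using refine(2)[OF \<tau>(1)] by blast
  have "\<mu> \<in> \<Sigma>'"
    using \<mu>(3)[OF \<mu>'(1)] \<tau> \<mu>'(2) by (metis subset_antisym subset_trans)
  moreover have "\<sigma> face_of \<mu>"
    using fan(1) \<sigma> \<mu> unfolding polyhedral_fan_def by (metis Int_absorb2)
  moreover have "\<sigma> \<noteq> {}"
    using fan(1) \<sigma> unfolding polyhedral_fan_def by blast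
  ultimately show "\<sigma> \<in> \<Sigma>'"
    using fan(2) unfolding polyhedral_fan_def by blast
qed

lemma coarsest_fan_on_unique:
  assumes "coarsest_fan_on S \<Sigma>" "coarsest_fan_on S \<Sigma>'"
  shows "\<Sigma> = \<Sigma>'"
  using coarsest_fan_on_subset assms by blast

section \<open>The three types of cells\<close>

definition min_attained_at :: "(nat \<Rightarrow> real) \<Rightarrow> nat set \<Rightarrow> nat \<Rightarrow> bool" where
  "min_attained_at a R r \<longleftrightarrow> r \<in> R \<and> (\<forall>t\<in>R. a r \<le> a t)"

definition triple_min_set ::
    "nat \<Rightarrow> (nat \<Rightarrow> 'm::finite) \<Rightarrow> nat \<Rightarrow> nat \<Rightarrow> nat \<Rightarrow> (real ^ 'm) set" where
  "triple_min_set n idx i j k =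
     {f. \<forall>r\<in>{i, j, k}. min_attained_at (\<lambda>t. f $ idx t) {0..n} r}"

definition nested_min_set ::
    "nat \<Rightarrow> nat \<Rightarrow> (nat \<Rightarrow> 'm::finite) \<Rightarrow> nat \<Rightarrow> nat \<Rightarrow> nat \<Rightarrow> nat \<Rightarrow> (real ^ 'm) set" where
  "nested_min_set p n idx i j k l =
     {f. (\<forall>r\<in>{i, j}. min_attained_at (\<lambda>t. f $ idx t) {0..n} r) \<and>
         (\<forall>r\<in>{k, l}. min_attained_at (\<lambda>t. f $ idx t) {t \<in> {0..n}. \<not> [t = i] (mod p)} r)}"

definition type_I_cells :: "nat \<Rightarrow> nat \<Rightarrow> (nat \<Rightarrow> 'm::finite) \<Rightarrow> (real ^ 'm) set set" where
  "type_I_cells p n idx =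
     {closure (triple_min_set n idx i j k) | i j k.
        {i, j, k} \<subseteq> {0..n} \<and>
        \<not> [i = j] (mod p) \<and> \<not> [i = k] (mod p) \<and> \<not> [j = k] (mod p)}"

definition type_II_cells :: "nat \<Rightarrow> nat \<Rightarrow> (nat \<Rightarrow> 'm::finite) \<Rightarrow> (real ^ 'm) set set" where
  "type_II_cells p n idx =
     {closure (nested_min_set p n idx i j k l) | i j k l.
        {i, j, k, l} \<subseteq> {0..n} \<and> i \<noteq> j \<and> [i = j] (mod p) \<and>
        \<not> [k = i] (mod p) \<and> \<not> [l = i] (mod p) \<and> \<not> [k = l] (mod p)}"

text \<open>
  In contrast to the ordered \<open>[{i,j},{k,l}]\<close> of type II, the symbol \<open>{{i,j},{k,l}}\<close> of type III is
  unordered: either of the two pairs may be the one at which the overall minimum is attained.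
  The two halves \<open>a\<^sub>i \<le> a\<^sub>k\<close> and \<open>a\<^sub>k \<le> a\<^sub>i\<close> form one convex cone, cut out by \<open>a\<^sub>i = a\<^sub>j \<le> a\<^sub>r\<close> for
  \<open>r\<close> not congruent to \<open>k\<close> and \<open>a\<^sub>k = a\<^sub>l \<le> a\<^sub>r\<close> for \<open>r\<close> not congruent to \<open>i\<close>; its points with
  \<open>a\<^sub>i = a\<^sub>k\<close> do not form a face.
\<close>

definition type_III_cells :: "nat \<Rightarrow> nat \<Rightarrow> (nat \<Rightarrow> 'm::finite) \<Rightarrow> (real ^ 'm) set set" where
  "type_III_cells p n idx =
     {closure (nested_min_set p n idx i j k l \<union> nested_min_set p n idx k l i j) | i j k l.
        {i, j, k, l} \<subseteq> {0..n} \<and> i \<noteq> j \<and> [i = j] (mod p) \<and>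
        \<not> [k = i] (mod p) \<and> k \<noteq> l \<and> [k = l] (mod p)}"

end

theory Submission
  imports Defs
begin

text \<open>
  A polynomial \<open>F\<close> with multiple root \<open>1\<close> satisfies \<open>\<Sum> A\<^sub>r = 0\<close> and \<open>\<Sum> (r - s) A\<^sub>r = 0\<close> for every \<open>s\<close>, and
  in characteristic \<open>p\<close> the coefficient \<open>r - s\<close> vanishes for \<open>r \<equiv> s\<close> and is a unit otherwise. So the
  minimum of the \<open>a\<^sub>r\<close> off any residue class is attained twice. Conversely, a generic point of one of
  the listed cones lifts by solving two linear equations, and the value group is dense because the
  field is algebraically closed.

  The rest depends only on the colouring of the indices by residues. All cones are cut out by
  comparisons of coordinates, and any two of them meet in a common face. For coarseness, let \<open>\<sigma>'\<close> be
  a cell of another fan with the same support \<open>H\<close>. The set of directions pointing from \<open>x\<close> into \<open>H\<close> is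
  the same for all \<open>x\<close> in the relative interior of \<open>\<sigma>'\<close>. Testing it on vectors that are \<open>0\<close> on one or
  two indices and \<open>1\<close> elsewhere singles out one cone that contains all these points.
\<close>

section \<open>Cells of a coloured double minimum space\<close>

text \<open>Coarseness is the delicate claim: the order of the coordinates may change along a cell
  while the space keeps its local shape. Inside a type III cone the sign of \<open>a_i - a_k\<close>
  changes and the space looks the same on both sides, so a coarsest fan must not break there. At a
  point whose minimum meets at most two colours, the space is locally a product of two conditions,
  each on its own block of indices. A test vector with one zero detects whether that index lies in a
  block; one with two zeros detects whether two such indices share a block. Where the minimum meets
  three colours, minimisers of different colours never behave like members of one block, and two
  blocks cannot keep three indices pairwise apart, so the two situations are told apart. Only the
  unordered pair of blocks is recovered. This is harmless, because the block at the overall minimum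
  is monochromatic: the two blocks can exchange their roles only for type III, whose cone is
  symmetric in the two pairs.\<close>

definition twice_min :: "'m set \<Rightarrow> real ^ 'm \<Rightarrow> bool" where
  "twice_min S f \<longleftrightarrow> (\<exists>i\<in>S. \<exists>j\<in>S. i \<noteq> j \<and> (\<forall>r\<in>S. f $ i \<le> f $ r \<and> f $ j \<le> f $ r))"

text \<open>The index \<open>s\<close> runs over all naturals, not only over colours. A value that
  is no colour removes nothing, and as the index type is finite such values exist; they give the
  condition on the overall minimum.\<close>

definition double_min_space :: "('m::finite \<Rightarrow> nat) \<Rightarrow> (real ^ 'm) set" where
  "double_min_space c = {f. \<forall>s. twice_min {r. c r \<noteq> s} f}"

definition triple_cell :: "'m::finite \<Rightarrow> 'm \<Rightarrow> 'm \<Rightarrow> (real ^ 'm) set" where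
  "triple_cell i j k = {f. f $ i = f $ j \<and> f $ i = f $ k \<and> (\<forall>r. f $ i \<le> f $ r)}"

text \<open>
  This covers types II and III at once: if \<open>c k = c l\<close>, then \<open>i, j\<close> need not attain the overall minimum.
\<close>

definition pair_cell :: "('m::finite \<Rightarrow> nat) \<Rightarrow> 'm \<Rightarrow> 'm \<Rightarrow> 'm \<Rightarrow> 'm \<Rightarrow> (real ^ 'm) set" where
  "pair_cell c i j k l =
     {f. f $ i = f $ j \<and> f $ k = f $ l \<and>
         (\<forall>r. \<not> (c r = c k \<and> c r = c l) \<longrightarrow> f $ i \<le> f $ r) \<and>
         (\<forall>r. c r \<noteq> c i \<longrightarrow> f $ k \<le> f $ r)}"

definition rainbow :: "('m \<Rightarrow> nat) \<Rightarrow> 'm \<Rightarrow> 'm \<Rightarrow> 'm \<Rightarrow> bool" where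
  "rainbow c i j k \<longleftrightarrow> c i \<noteq> c j \<and> c i \<noteq> c k \<and> c j \<noteq> c k"

definition paired :: "('m \<Rightarrow> nat) \<Rightarrow> 'm \<Rightarrow> 'm \<Rightarrow> 'm \<Rightarrow> 'm \<Rightarrow> bool" where
  "paired c i j k l \<longleftrightarrow> i \<noteq> j \<and> c i = c j \<and> k \<noteq> l \<and> c k \<noteq> c i \<and> c l \<noteq> c i"

definition cells :: "('m::finite \<Rightarrow> nat) \<Rightarrow> (real ^ 'm) set set" where
  "cells c = {triple_cell i j k | i j k. rainbow c i j k} \<union>
             {pair_cell c i j k l | i j k l. paired c i j k l}"

lemma cells_cases [consumes 1, case_names triple pair]:
  assumes "\<sigma> \<in> cells c"
  obtains i j k where "\<sigma> = triple_cell i j k" "rainbow c i j k"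
    | i j k l where "\<sigma> = pair_cell c i j k l" "paired c i j k l"
  using assms unfolding cells_def by blast

section \<open>Finitely many polyhedral cones inside the space\<close>

lemma finite_cells: "finite (cells c)"
proof -
  have "cells c \<subseteq> (\<lambda>(i, j, k). triple_cell i j k) ` UNIV \<union>
      (\<lambda>(i, j, k, l). pair_cell c i j k l) ` UNIV"
    unfolding cells_def by (force simp: image_def)
  then show ?thesis
    by (rule finite_subset) simp
qed

lemma polyhedron_coordinate_le: "polyhedron {f :: real ^ 'm::finite. f $ r \<le> f $ t}"
proof -
  have "{f :: real ^ 'm. f $ r \<le> f $ t} = {f. (axis r 1 - axis t 1) \<bullet> f \<le> 0}"
    by (simp add: inner_diff_left inner_axis' )
  then show ?thesis by (simp add: polyhedron_halfspace_le)
qed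

lemma polyhedron_coordinate_le_if: "polyhedron {f :: real ^ 'm::finite. P \<longrightarrow> f $ r \<le> f $ t}"
  by (cases P) (simp_all add: polyhedron_coordinate_le)

lemma polyhedron_Collect_all:
  fixes P :: "'m::finite \<Rightarrow> 'a::euclidean_space \<Rightarrow> bool"
  assumes "\<And>r. polyhedron {f. P r f}"
  shows "polyhedron {f. \<forall>r. P r f}"
proof -
  have "{f. \<forall>r. P r f} = \<Inter> (range (\<lambda>r. {f. P r f}))" by auto
  then show ?thesis using assms by (auto intro!: polyhedron_Inter)
qed

lemma polyhedron_Collect_conj:
  "polyhedron {f. P f} \<Longrightarrow> polyhedron {f. Q f} \<Longrightarrow> polyhedron {f. P f \<and> Q f}"
  by (simp add: Collect_conj_eq)

lemma polyhedron_coordinate_eq: "polyhedron {f :: real ^ 'm::finite. f $ r = f $ t}"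
  using polyhedron_Collect_conj[OF polyhedron_coordinate_le[of r t] polyhedron_coordinate_le[of t r]]
  by (simp add: order_eq_iff)

lemma cells_polyhedron:
  assumes "\<sigma> \<in> cells c" shows "polyhedron \<sigma>"
  using assms
  by (cases rule: cells_cases)
    (auto simp only: triple_cell_def pair_cell_def intro!: polyhedron_Collect_conj polyhedron_Collect_all
      polyhedron_coordinate_eq polyhedron_coordinate_le polyhedron_coordinate_le_if)

lemma cells_cone:
  assumes "\<sigma> \<in> cells c" shows "cone \<sigma>" "0 \<in> \<sigma>"
  using assms
  by (cases rule: cells_cases; auto simp: triple_cell_def pair_cell_def cone_def mult_left_mono)+

lemma pair_cell_commute:
  "c i = c j \<Longrightarrow> pair_cell c j i k l = pair_cell c i j k l"
  "pair_cell c i j l k = pair_cell c i j k l"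
  unfolding pair_cell_def by auto

text \<open>With both pairs monochromatic, exchanging them only exchanges the two families of
  inequalities. This symmetry is the unordered symbol of type III.\<close>

lemma pair_cell_swap:
  assumes "c i = c j" "c k = c l" shows "pair_cell c k l i j = pair_cell c i j k l"
  using assms unfolding pair_cell_def by auto

text \<open>Removing one colour removes at most one of \<open>i\<close>, \<open>j\<close>,
  \<open>k\<close>, so two overall minimisers survive.\<close>

lemma triple_cell_subset:
  assumes "rainbow c i j k" shows "triple_cell i j k \<subseteq> double_min_space c"
proof
  fix f assume f: "f \<in> triple_cell i j k"
  have "twice_min {r. c r \<noteq> s} f" for s
  proof -
    have tw: "twice_min {r. c r \<noteq> s} f" if "c a \<noteq> s" "c b \<noteq> s" "a \<noteq> b" "a \<in> {i, j, k}" "b \<in> {i, j, k}" for a b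
    proof -
      have "\<forall>r\<in>{r. c r \<noteq> s}. f $ a \<le> f $ r \<and> f $ b \<le> f $ r"
        using that(4,5) f unfolding triple_cell_def by auto
      then show ?thesis using that(1-3) unfolding twice_min_def by blast
    qed
    consider "c i \<noteq> s" "c j \<noteq> s" | "c i \<noteq> s" "c k \<noteq> s" | "c j \<noteq> s" "c k \<noteq> s"
      using assms unfolding rainbow_def by metis
    then show ?thesis using assms tw[of i j] tw[of i k] tw[of j k] unfolding rainbow_def by cases auto
  qed
  then show "f \<in> double_min_space c" by (simp add: double_min_space_def)
qed

lemma pair_cell_subset:
  assumes "paired c i j k l" shows "pair_cell c i j k l \<subseteq> double_min_space c"
proof
  fix f assume f: "f \<in> pair_cell c i j k l"
  have ij: "f $ i = f $ j" "f $ k = f $ l" "\<And>r. \<not> (c r = c k \<and> c r = c l) \<Longrightarrow> f $ i \<le> f $ r"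
    "\<And>r. c r \<noteq> c i \<Longrightarrow> f $ k \<le> f $ r"
    using f unfolding pair_cell_def by auto
  have p: "i \<noteq> j" "c i = c j" "k \<noteq> l" "c k \<noteq> c i" "c l \<noteq> c i"
    using assms unfolding paired_def by auto
  have "twice_min {r. c r \<noteq> s} f" for s
  proof -
    \<comment> \<open>Removing the colour of \<open>i\<close>, \<open>j\<close> leaves the minimum
      at \<open>k\<close>, \<open>l\<close>. Any other colour spares \<open>i\<close>,
      \<open>j\<close>, and they attain the minimum unless \<open>k\<close>, \<open>l\<close> are
      lower and still present; that can happen only for a monochromatic pair \<open>k\<close>,
      \<open>l\<close>, which then takes over.\<close>
    consider "s = c i" | "s \<noteq> c i" "f $ i \<le> f $ k \<or> c k \<noteq> c l \<or> (s = c k \<and> s = c l)" | "s \<noteq> c i" "f $ k < f $ i" "c k = c l" "s \<noteq> c k"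
      by linarith
    then show ?thesis
    proof cases
      case 1 
      then have "\<forall>r\<in>{r. c r \<noteq> s}. f $ k \<le> f $ r \<and> f $ l \<le> f $ r" using ij by auto
      then show ?thesis using p 1 unfolding twice_min_def by blast
    next
      case 2
      have "\<forall>r\<in>{r. c r \<noteq> s}. f $ i \<le> f $ r" using 2 ij(3,4) p by (smt (verit) mem_Collect_eq)
      then show ?thesis using p 2 ij(1) unfolding twice_min_def by (metis (mono_tags, lifting) mem_Collect_eq)
    next
      case 3
      have "\<forall>r\<in>{r. c r \<noteq> s}. f $ k \<le> f $ r" using 3 ij(3,4) p by (smt (verit) mem_Collect_eq)
      then show ?thesis using p 3 ij(2) unfolding twice_min_def by (metis (mono_tags, lifting) mem_Collect_eq)
    qed
  qed
  then show "f \<in> double_min_space c" by (simp add: double_min_space_def)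
qed

section \<open>Two cones meet in a common face\<close>

lemma interpolated_eq:
  fixes a b u :: real
  assumes "0 < u" "u < 1" "a \<le> a'" "b \<le> b'" "(1 - u) * a' + u * b' \<le> (1 - u) * a + u * b"
  shows "a = a'"
proof (rule antisym)
  have "u * b \<le> u * b'" using assms by simp
  then have "(1 - u) * a' \<le> (1 - u) * a" using assms(5) by linarith
  then show "a' \<le> a" using assms(2) by simp
qed (fact assms(3))

text \<open>Every comparison forced by \<open>\<sigma>\<close> holds at both ends of the segment
  (\<open>le\<close>), every comparison forced by \<open>\<tau>\<close> holds at the interior point
  (\<open>xle\<close>). Where the two run in opposite directions, \<open>interpolated_eq\<close>
  makes the coordinates of \<open>a\<close> equal. What remains is to find, from the colours alone,
  enough opposite comparisons to place \<open>a\<close> in \<open>\<tau>\<close>.\<close>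

lemma cells_segment:
  assumes \<sigma>: "\<sigma> \<in> cells c" and \<tau>: "\<tau> \<in> cells c"
    and a: "a \<in> \<sigma>" and b: "b \<in> \<sigma>" and u: "0 < u" "u < 1" and x: "(1 - u) *\<^sub>R a + u *\<^sub>R b \<in> \<tau>"
  shows "a \<in> \<tau>"
proof -
  define x where "x = (1 - u) *\<^sub>R a + u *\<^sub>R b"
  define le where "le r t \<longleftrightarrow> a $ r \<le> a $ t \<and> b $ r \<le> b $ t" for r t
  define xle where "xle r t \<longleftrightarrow> x $ r \<le> x $ t" for r t
  have xx: "x \<in> \<tau>" using x by (simp add: x_def)
  have xa: "x $ r = (1 - u) * a $ r + u * b $ r" for r by (simp add: x_def)
  have le: "xle r t" if "le r t" for r t
    using that u by (simp add: le_def xle_def xa add_mono mult_left_mono)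
  have eq: "a $ r = a $ t" if "le r t" "xle t r" for r t
    using interpolated_eq[OF u, of "a $ r" "a $ t" "b $ r" "b $ t"] that by (simp add: le_def xle_def xa)
  have le_a: "a $ r \<le> a $ t" if "le r t" for r t using that by (simp add: le_def)
  have tr: "xle r t" if "xle r s" "xle s t" for r s t using that by (simp add: xle_def)
  show ?thesis
    using \<sigma>
  proof (cases rule: cells_cases)
    case S: (triple i j k)
    have s: "le i j" "le j i" "le i k" "le k i" "\<And>r. le i r"
      using a b unfolding S triple_cell_def le_def by auto
    from \<tau> show ?thesis
    proof (cases rule: cells_cases)
      case T: (triple i' j' k')
      have t: "xle i' j'" "xle j' i'" "xle i' k'" "xle k' i'" "\<And>r. xle i' r"
        using xx unfolding T triple_cell_def xle_def by auto
      show ?thesis using s t eq tr le_a unfolding T triple_cell_def by (smt (verit) mem_Collect_eq)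
    next
      case T: (pair i' j' k' l')
      have t: "xle i' j'" "xle j' i'" "xle l' k'" "xle k' l'"
        "\<And>r. \<not> (c r = c k' \<and> c r = c l') \<Longrightarrow> xle i' r" "\<And>r. c r \<noteq> c i' \<Longrightarrow> xle k' r"
        using xx unfolding T pair_cell_def xle_def by auto
      \<comment> \<open>Three colours leave one that avoids the class exempt from comparison with
        \<open>i'\<close>, and one that avoids the colour of \<open>i'\<close>. Hence both
        \<open>i'\<close> and \<open>k'\<close> lie below the overall minimum level of
        \<open>\<sigma>\<close>.\<close>
      obtain m where m: "m \<in> {i, j, k}" "\<not> (c m = c k' \<and> c m = c l')" using S(2) unfolding rainbow_def by (metis insertCI)
      obtain m' where m': "m' \<in> {i, j, k}" "c m' \<noteq> c i'" using S(2) unfolding rainbow_def by (metis insertCI)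
      have mi: "xle m i" "xle m' i" using m m' s le tr by auto
      have xi: "xle i' i" "xle k' i" using t(5)[OF m(2)] t(6)[OF m'(2)] mi tr by blast+
      have "a $ i = a $ i'" "a $ i = a $ j'" "a $ i = a $ k'" "a $ i = a $ l'"
        using eq[OF s(5)] xi tr[OF t(2) xi(1)] tr[OF t(3) xi(2)] by blast+
      then show ?thesis using le_a[OF s(5)] unfolding T pair_cell_def by auto
    qed
  next
    case S: (pair i j k l)
    have s: "le i j" "le j i" "le l k" "le k l"
      "\<And>r. \<not> (c r = c k \<and> c r = c l) \<Longrightarrow> le i r" "\<And>r. c r \<noteq> c i \<Longrightarrow> le k r"
      using a b unfolding S pair_cell_def le_def by auto
    have sp: "c j = c i" "c k \<noteq> c i" "c l \<noteq> c i" using S(2) by (auto simp: paired_def)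
    have aij: "a $ i = a $ j" "a $ k = a $ l" using s le_a by (metis antisym)+
    from \<tau> show ?thesis
    proof (cases rule: cells_cases)
      case T: (triple i' j' k')
      have t: "xle i' j'" "xle j' i'" "xle i' k'" "xle k' i'" "\<And>r. xle i' r"
        using xx unfolding T triple_cell_def xle_def by auto
      have t': "xle m r" if "m \<in> {i', j', k'}" for m r using t tr that by blast
      \<comment> \<open>Of three colours, one differs from that of \<open>i\<close> and from the
        possible common colour of \<open>k\<close>, \<open>l\<close>. Its index is comparable with
        both pairs of \<open>\<sigma>\<close> and forces their values to agree.\<close>
      obtain m where m: "m \<in> {i', j', k'}" "c m \<noteq> c i" "\<not> (c m = c k \<and> c m = c l)"
        using T(2) S(2) unfolding rainbow_def paired_def by (metis insertCI)
      have e: "a $ i = a $ m" "a $ k = a $ m" using m s t' eq by blast+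
      have e': "a $ i = a $ m'" if "m' \<in> {i', j', k'}" for m'
      proof (cases "c m' = c i")
        case True
        then have "le i m'" using s(5)[of m'] sp by auto
        then show ?thesis using eq t'[OF that] by blast
      next
        case False
        then show ?thesis using eq[OF s(6)[OF False] t'[OF that]] e by simp
      qed
      have "a $ i \<le> a $ r" for r
        using le_a[OF s(5)[of r]] le_a[OF s(6)[of r]] e sp by fastforce
      then show ?thesis using e'[of i'] e'[of j'] e'[of k'] unfolding T triple_cell_def by simp
    next
      case T: (pair i' j' k' l')
      have t: "xle i' j'" "xle j' i'" "xle l' k'" "xle k' l'"
        "\<And>r. \<not> (c r = c k' \<and> c r = c l') \<Longrightarrow> xle i' r" "\<And>r. c r \<noteq> c i' \<Longrightarrow> xle k' r"
        using xx unfolding T pair_cell_def xle_def by auto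
      have tp: "c j' = c i'" "c k' \<noteq> c i'" "c l' \<noteq> c i'" using T(2) by (auto simp: paired_def)
      have kl: "xle k l" "xle l k" using s le by blast+
      have conclude: ?thesis
        if "a $ i' = a $ j'" "a $ k' = a $ l'" "\<And>r. \<not> (c r = c k' \<and> c r = c l') \<Longrightarrow> a $ i' \<le> a $ r"
          "\<And>r. c r \<noteq> c i' \<Longrightarrow> a $ k' \<le> a $ r"
        using that unfolding T pair_cell_def by auto
      \<comment> \<open>Call a class exempt if it is the common colour of the second pair, so that
        the first pair is not compared with it. The cases are: equal first colours; two type III
        cones with exchanged colours; exactly one of the two first colours exempt in the other cone
        (twice); neither, but with the same exempt class; and the rest. In the last four, some pair
        of \<open>\<sigma>\<close> is shown to attain the overall minimum of \<open>a\<close>, which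
        supplies the comparisons missing for exempt classes.\<close>
      consider "c i' = c i"
        | "c i' \<noteq> c i" "c k' = c i" "c l' = c i" "c k = c i'" "c l = c i'"
        | "c i' \<noteq> c i" "c k' = c i" "c l' = c i" "\<not> (c i' = c k \<and> c i' = c l)"
        | "c i' \<noteq> c i" "\<not> (c i = c k' \<and> c i = c l')" "c k = c i'" "c l = c i'"
        | "c i' \<noteq> c i" "\<not> (c i = c k' \<and> c i = c l')" "\<not> (c i' = c k \<and> c i' = c l)"
          "c k = c l" "c k' = c k" "c l' = c k"
        | "c i' \<noteq> c i" "\<not> (c i = c k' \<and> c i = c l')" "\<not> (c i' = c k \<and> c i' = c l)"
          "\<not> (c k = c l \<and> c k' = c k \<and> c l' = c k)"
        by metis
      then show ?thesis
      proof cases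
        case 1
        have "xle i' i" using t(5)[of i] tp 1 by auto
        then have i: "a $ i = a $ i'" "a $ i = a $ j'"
          using eq[OF s(5)[of i']] eq[OF s(5)[of j']] tr[OF t(2)] sp tp 1 by auto
        have "xle k' k" using t(6)[of k] sp 1 by auto
        then have k: "a $ k = a $ k'" "a $ k = a $ l'"
          using eq[OF s(6)[of k']] eq[OF s(6)[of l']] tr[OF t(3)] tp 1 by auto
        show ?thesis
        proof (rule conclude)
          fix r assume r: "\<not> (c r = c k' \<and> c r = c l')"
          show "a $ i' \<le> a $ r"
          proof (cases "c r = c k \<and> c r = c l")
            case True
            then have "\<not> (c k' = c k \<and> c k' = c l) \<or> \<not> (c l' = c k \<and> c l' = c l)" using r by metis
            then have "a $ i \<le> a $ k" using le_a[OF s(5)[of k']] le_a[OF s(5)[of l']] k by auto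
            moreover have "a $ k \<le> a $ r" using le_a[OF s(6)[of r]] True sp by auto
            ultimately show ?thesis using i by simp
          qed (use le_a[OF s(5)[of r]] i in auto)
        next
          fix r assume "c r \<noteq> c i'"
          then show "a $ k' \<le> a $ r" using le_a[OF s(6)[of r]] k 1 by auto
        qed (use i k in auto)
      next
        case 2
        have "xle i' k" "xle k' i" using t(5)[of k] t(6)[of i] 2 by auto
        then have i: "a $ k = a $ i'" "a $ k = a $ j'" "a $ i = a $ k'" "a $ i = a $ l'"
          using eq[OF s(6)[of i']] eq[OF s(6)[of j']] eq[OF s(5)[of k']] eq[OF s(5)[of l']]
            tr[OF t(2)] tr[OF t(3)] tp 2 by auto
        show ?thesis
          by (rule conclude) (use i 2 le_a[OF s(5)] le_a[OF s(6)] in auto)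
      next
        case 3
        have "xle i' k \<or> xle i' l" using t(5)[of k] t(5)[of l] 3 sp by auto
        then have "xle i' k" "xle k' i" using tr[OF _ kl(2)] t(6)[of i] 3 by auto
        then have i: "a $ k = a $ i'" "a $ k = a $ j'" "a $ i = a $ k'" "a $ i = a $ l'"
          using eq[OF s(6)[of i']] eq[OF s(6)[of j']] eq[OF s(5)[of k']] eq[OF s(5)[of l']]
            tr[OF t(2)] tr[OF t(3)] tp 3 sp by auto
        have "a $ i \<le> a $ k" using le_a[OF s(5)[of i']] i 3 by auto
        then have all: "a $ i \<le> a $ r" for r
          using le_a[OF s(5)[of r]] le_a[OF s(6)[of r]] sp by fastforce
        show ?thesis
          by (rule conclude) (use i 3 all le_a[OF s(6)] in auto)
      next
        case 4
        have "xle i' k" "xle k' i" using t(5)[of k] t(6)[of i] 4 tp by auto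
        then have i: "a $ k = a $ i'" "a $ k = a $ j'" "a $ i = a $ k'" "a $ i = a $ l'"
          using eq[OF s(6)[of i']] eq[OF s(6)[of j']] eq[OF s(5)[of k']] eq[OF s(5)[of l']]
            tr[OF t(2)] tr[OF t(3)] tp 4 by auto
        have "a $ k \<le> a $ i" using le_a[OF s(6)[of k']] le_a[OF s(6)[of l']] i 4(2) by metis
        then have all: "a $ k \<le> a $ r" for r
          using le_a[OF s(5)[of r]] le_a[OF s(6)[of r]] sp by fastforce
        show ?thesis
          by (rule conclude) (use i 4 all le_a[OF s(5)] in auto)
      next
        case 5
        have "xle i' i" "xle k' k" using t(5)[of i] t(6)[of k] 5 by auto
        then have i: "a $ i = a $ i'" "a $ i = a $ j'" "a $ k = a $ k'" "a $ k = a $ l'"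
          using eq[OF s(5)[of i']] eq[OF s(5)[of j']] eq[OF s(6)[of k']] eq[OF s(6)[of l']]
            tr[OF t(2)] tr[OF t(3)] tp 5 by auto
        have "a $ k \<le> a $ i" using le_a[OF s(6)[of i']] i 5 by auto
        then have all: "a $ k \<le> a $ r" for r
          using le_a[OF s(5)[of r]] le_a[OF s(6)[of r]] sp by fastforce
        show ?thesis
          by (rule conclude) (use i 5 all le_a[OF s(5)] in auto)
      next
        case 6
        have "xle i' i" using t(5)[of i] 6 by auto
        then have i: "a $ i = a $ i'" "a $ i = a $ j'"
          using eq[OF s(5)[of i']] eq[OF s(5)[of j']] tr[OF t(2)] tp 6 by auto
        have "xle k' k \<or> xle k' l" using t(6)[of k] t(6)[of l] 6(3) by metis
        then have k'k: "xle k' k" "xle l' k" using tr[OF _ kl(2)] tr[OF t(3)] by blast+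
        have "le i k' \<or> le i l'" using s(5)[of k'] s(5)[of l'] 6(4) by metis
        then have ik: "xle i k" using le[of i k'] le[of i l'] tr[OF _ k'k(1)] tr[OF _ k'k(2)] by blast
        have ki: "xle k i" using le[OF s(6)[of i']] tr[OF _ \<open>xle i' i\<close>] 6 by auto
        have "a $ k = a $ i'" using eq[OF s(6)[of i']] tr[OF \<open>xle i' i\<close> ik] 6 by auto
        then have ik': "a $ k = a $ i" using i by simp
        have m: "a $ i = a $ m" if "m \<in> {k', l'}" for m
        proof (cases "c m = c i")
          case True
          then show ?thesis using eq[OF s(5)[of m]] k'k tr[OF _ ki] that sp by auto
        next
          case False
          then show ?thesis using eq[OF s(6)[of m]] k'k that ik' by auto
        qed
        have "a $ i \<le> a $ r" for r
          using le_a[OF s(5)[of r]] le_a[OF s(6)[of r]] sp ik' by fastforce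
        then show ?thesis
          by (intro conclude) (use i m[of k'] m[of l'] in auto)
      qed
    qed
  qed
qed

lemma cells_Int_face:
  assumes "\<sigma> \<in> cells c" "\<tau> \<in> cells c"
  shows "(\<sigma> \<inter> \<tau>) face_of \<sigma>"
  unfolding face_of_def
proof (intro conjI ballI impI)
  show "convex (\<sigma> \<inter> \<tau>)"
    using assms by (intro convex_Int polyhedron_imp_convex cells_polyhedron)
  fix a b x assume a: "a \<in> \<sigma>" and b: "b \<in> \<sigma>" and x: "x \<in> \<sigma> \<inter> \<tau>" "x \<in> open_segment a b"
  obtain u where u: "0 < u" "u < 1" "x = (1 - u) *\<^sub>R a + u *\<^sub>R b"
    using x(2) by (auto simp: in_segment)
  show "a \<in> \<sigma> \<inter> \<tau>" using cells_segment[OF assms a b u(1,2)] u(3) x(1) a by simp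
  show "b \<in> \<sigma> \<inter> \<tau>" using cells_segment[OF assms b a, of "1 - u"] u x(1) b by (simp add: add.commute)
qed simp

section \<open>No cone contains another\<close>

definition unit_off :: "'m set \<Rightarrow> real ^ 'm" where
  "unit_off S = (\<chi> r. if r \<in> S then 0 else 1)"

lemma unit_off_nth [simp]: "unit_off S $ r = (if r \<in> S then 0 else 1)"
  by (simp add: unit_off_def)

text \<open>A point of \<open>\<sigma>\<close> with no more ties at its low levels than
  \<open>\<sigma>\<close> demands already determines the indices that define \<open>\<tau>\<close>.
  For a triple it is the vector with three zeros, for two pairs a vector with the levels 0, 1 and
  2.\<close>

lemma cells_antichain:
  assumes \<sigma>: "\<sigma> \<in> cells c" and \<tau>: "\<tau> \<in> cells c" and sub: "\<sigma> \<subseteq> \<tau>"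
  shows "\<sigma> = \<tau>"
  using \<sigma>
proof (cases rule: cells_cases)
  case S: (triple i j k)
  have "unit_off {i, j, k} \<in> \<sigma>" unfolding S triple_cell_def by simp
  with sub have g: "unit_off {i, j, k} \<in> \<tau>" by blast
  from \<tau> show ?thesis
  proof (cases rule: cells_cases)
    case T: (triple i' j' k')
    have "unit_off {i, j, k} $ i' \<le> (unit_off {i, j, k} $ i :: real)"
      "unit_off {i, j, k} $ i' = (unit_off {i, j, k} $ j' :: real)"
      "unit_off {i, j, k} $ i' = (unit_off {i, j, k} $ k' :: real)"
      using g unfolding T triple_cell_def by blast+
    then have "{i', j', k'} \<subseteq> {i, j, k}" by (auto split: if_splits)
    then have "{i', j', k'} = {i, j, k}"
      using T(2) S(2) unfolding rainbow_def by auto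
    moreover have "triple_cell a b c = {f. \<forall>q\<in>{a, b, c}. \<forall>r. f $ q \<le> f $ r}" for a b c :: 'a
      unfolding triple_cell_def by (auto intro: antisym)
    ultimately show ?thesis unfolding S(1) T(1) by (simp only:)
  next
    case T: (pair i' j' k' l')
    let ?g = "unit_off {i, j, k}"
    have t: "?g $ i' = (?g $ j' :: real)" "\<And>r. \<not> (c r = c k' \<and> c r = c l') \<Longrightarrow> ?g $ i' \<le> ?g $ r"
      using g unfolding T pair_cell_def by blast+
    have "i' \<notin> {i, j, k}"
    proof
      assume "i' \<in> {i, j, k}"
      with t(1) have "j' \<in> {i, j, k}" by (simp split: if_splits)
      with \<open>i' \<in> {i, j, k}\<close> show False using S(2) T(2) unfolding rainbow_def paired_def by auto
    qed
    \<comment> \<open>Since \<open>i'\<close> has value 1, an index of value 0 can only escape the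
      comparison by being exempt; but exempt indices share one colour.\<close>
    then have "c r = c k'" if "r \<in> {i, j, k}" for r
      using t(2)[of r] that by (metis unit_off_nth not_one_le_zero)
    then show ?thesis using S(2) unfolding rainbow_def by auto
  qed
next
  case S: (pair i j k l)
  \<comment> \<open>Level 0 on the first pair, 1 on the second and 2 elsewhere: the strict steps
    rule out any further coincidence.\<close>
  define g where "g = unit_off {i, j} + unit_off {i, j, k, l}"
  have sp: "c j = c i" "c k \<noteq> c i" "c l \<noteq> c i" "i \<noteq> j" "k \<noteq> l" using S(2) by (auto simp: paired_def)
  have gv: "g $ r = (if r \<in> {i, j} then 0 else if r \<in> {k, l} then 1 else 2)" for r
    using sp by (auto simp: g_def)
  have "g \<in> \<sigma>" unfolding S pair_cell_def using sp by (auto simp: gv)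
  with sub have g: "g \<in> \<tau>" by blast
  from \<tau> show ?thesis
  proof (cases rule: cells_cases)
    case T: (triple i' j' k')
    have "g $ i' \<le> g $ i" "g $ i' = g $ j'" "g $ i' = g $ k'"
      using g unfolding T triple_cell_def by blast+
    then have "{i', j', k'} \<subseteq> {i, j}" by (auto simp: gv split: if_splits)
    then show ?thesis using T(2) unfolding rainbow_def by auto
  next
    case T: (pair i' j' k' l')
    have t: "g $ i' = g $ j'" "g $ k' = g $ l'" "\<And>r. \<not> (c r = c k' \<and> c r = c l') \<Longrightarrow> g $ i' \<le> g $ r"
      "\<And>r. c r \<noteq> c i' \<Longrightarrow> g $ k' \<le> g $ r"
      using g unfolding T pair_cell_def by blast+
    have tp: "c j' = c i'" "c k' \<noteq> c i'" "c l' \<noteq> c i'" "i' \<noteq> j'" "k' \<noteq> l'" using T(2) by (auto simp: paired_def)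
    have small: "g $ i < 2" "g $ k < 2" by (simp_all add: gv)
    have "g $ i' \<noteq> 2"
      \<comment> \<open>As \<open>i\<close> and \<open>k\<close> have different colours, at least
        one of them is not exempt in \<open>\<tau>\<close> and bounds the value at \<open>i'\<close>
        below 2. The same argument with the colour of \<open>i'\<close> bounds the value at
        \<open>k'\<close>.\<close>
      using t(3)[of i] t(3)[of k] sp small by (metis not_le)
    then have 1: "{i', j'} = {i, j} \<or> {i', j'} = {k, l}"
      using t(1) tp(4) by (auto simp: gv split: if_splits)
    have "g $ k' \<noteq> 2"
      using t(4)[of i] t(4)[of k] sp small by (metis not_le)
    then have "{k', l'} = {i, j} \<or> {k', l'} = {k, l}"
      using t(2) tp(5) by (auto simp: gv split: if_splits)
    with 1 consider "{i', j'} = {i, j}" "{k', l'} = {k, l}" | "{i', j'} = {k, l}" "{k', l'} = {i, j}"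
      using tp by (metis doubleton_eq_iff)
    then show ?thesis
    proof cases
      case 1
      then show ?thesis
        using pair_cell_commute(1)[of c i j k l] pair_cell_commute(2)[of c _ _ k l] sp(1)
        unfolding S(1) T(1) doubleton_eq_iff by auto
    next
      case 2
      then have "pair_cell c i' j' k' l' = pair_cell c k l i j"
        using pair_cell_commute(1)[of c k l i j] pair_cell_commute(2)[of c _ _ i j] tp(1)
        unfolding doubleton_eq_iff by auto
      also have "\<dots> = pair_cell c i j k l"
        using 2 sp tp by (intro pair_cell_swap) (auto simp: doubleton_eq_iff)
      finally show ?thesis unfolding S T ..
    qed
  qed
qed

section \<open>The fan of all faces of a family of cones\<close>

lemma cone_face_of:
  fixes S :: "'a::euclidean_space set"
  assumes F: "F face_of S" and S: "cone S"
  shows "cone F"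
  unfolding cone_def
proof (intro ballI allI impI)
  fix x and t :: real assume x: "x \<in> F" and t: "0 \<le> t"
  show "t *\<^sub>R x \<in> F"
  proof (cases "x = 0")
    case False
    \<comment> \<open>\<open>M > 1\<close> puts \<open>x\<close> strictly between 0 and
      \<open>M *\<^sub>R x\<close>, so a face containing \<open>x\<close> contains both ends;
      \<open>M \<ge> t\<close> puts \<open>t *\<^sub>R x\<close> on that segment.\<close>
    define M where "M = max t 1 + 1"
    have M: "M > 1" "t \<le> M" by (auto simp: M_def)
    have "x \<in> S" using F x face_of_imp_subset by blast
    then have "0 *\<^sub>R x \<in> S" "M *\<^sub>R x \<in> S" using S M unfolding cone_def by (meson le_less_trans less_imp_le zero_le_one order_refl)+
    moreover have "x = (1 - 1 / M) *\<^sub>R (0 *\<^sub>R x) + (1 / M) *\<^sub>R (M *\<^sub>R x)" using M by simp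
    then have "x \<in> open_segment (0 *\<^sub>R x) (M *\<^sub>R x)"
      unfolding in_segment using M False by (intro conjI exI[of _ "1 / M"]) auto
    ultimately have "0 *\<^sub>R x \<in> F" "M *\<^sub>R x \<in> F" using F x unfolding face_of_def by blast+
    then have "(1 - t / M) *\<^sub>R (0 *\<^sub>R x) + (t / M) *\<^sub>R (M *\<^sub>R x) \<in> F"
      using face_of_imp_convex[OF F] t M by (intro convexD_alt) auto
    then show ?thesis using M by simp
  qed (use x in simp)
qed

text \<open>It is enough that the given cones meet in faces. If \<open>F\<close>, \<open>G\<close>
  are faces of \<open>\<sigma>\<close>, \<open>\<tau>\<close>, then \<open>G\<close> cuts a face out
  of \<open>\<sigma> \<inter> \<tau>\<close>, which is therefore a face of \<open>\<sigma>\<close>;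
  intersecting it with \<open>F\<close> gives \<open>F \<inter> G\<close>.\<close>

lemma polyhedral_fan_faces:
  fixes C :: "'a::euclidean_space set set"
  assumes fin: "finite C" and poly: "\<And>\<sigma>. \<sigma> \<in> C \<Longrightarrow> polyhedron \<sigma>" and cone: "\<And>\<sigma>. \<sigma> \<in> C \<Longrightarrow> cone \<sigma>"
    and face: "\<And>\<sigma> \<tau>. \<sigma> \<in> C \<Longrightarrow> \<tau> \<in> C \<Longrightarrow> (\<sigma> \<inter> \<tau>) face_of \<sigma>"
  shows "polyhedral_fan {F. F \<noteq> {} \<and> (\<exists>\<sigma>\<in>C. F face_of \<sigma>)}" (is "polyhedral_fan ?\<Sigma>")
proof -
  have "?\<Sigma> \<subseteq> (\<Union>\<sigma>\<in>C. {F. F face_of \<sigma>})" by auto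
  then have "finite ?\<Sigma>"
    by (rule finite_subset) (use fin poly finite_polyhedron_faces in auto)
  moreover have int: "(F \<inter> G) face_of F" if "\<sigma> \<in> C" "\<tau> \<in> C" "F face_of \<sigma>" "G face_of \<tau>" for F G \<sigma> \<tau>
  proof -
    have \<sigma>\<tau>: "(\<sigma> \<inter> \<tau>) face_of \<sigma>" "(\<sigma> \<inter> \<tau>) face_of \<tau>"
      using face that by (metis Int_commute)+
    have G: "(G \<inter> (\<sigma> \<inter> \<tau>)) face_of (\<sigma> \<inter> \<tau>)"
      using face_of_Int[OF that(4) \<sigma>\<tau>(2)] face_of_subset by (metis Int_lower2)
    then have "(G \<inter> (\<sigma> \<inter> \<tau>)) face_of \<sigma>" using \<sigma>\<tau>(1) face_of_trans by blast
    then have "(F \<inter> (G \<inter> (\<sigma> \<inter> \<tau>))) face_of \<sigma>" using face_of_Int[OF that(3)] by blast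
    moreover have "F \<inter> (G \<inter> (\<sigma> \<inter> \<tau>)) = F \<inter> G"
      using that(3,4) face_of_imp_subset by blast
    ultimately show ?thesis
      using that(3) face_of_subset face_of_imp_subset by (metis inf_le1)
  qed
  ultimately show ?thesis
    unfolding polyhedral_fan_def
  proof (intro conjI ballI allI impI)
    fix F assume "F \<in> ?\<Sigma>"
    then show "polyhedron F" "cone F" "F \<noteq> {}"
      using face_of_polyhedron_polyhedron poly cone_face_of cone by blast+
  next
    fix F G assume "F \<in> ?\<Sigma>" "G face_of F \<and> G \<noteq> {}"
    then show "G \<in> ?\<Sigma>" using face_of_trans by blast
  next
    fix F G assume "F \<in> ?\<Sigma>" "G \<in> ?\<Sigma>"
    then obtain \<sigma> \<tau> where "\<sigma> \<in> C" "\<tau> \<in> C" "F face_of \<sigma>" "G face_of \<tau>" by blast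
    then show "(F \<inter> G) face_of F" "(F \<inter> G) face_of G"
      using int[of \<sigma> \<tau> F G] int[of \<tau> \<sigma> G F] by (simp_all add: Int_commute)
  qed auto
qed

lemma maximal_cells_faces:
  fixes C :: "'a::euclidean_space set set"
  assumes "\<And>\<sigma>. \<sigma> \<in> C \<Longrightarrow> polyhedron \<sigma>" "\<And>\<sigma>. \<sigma> \<in> C \<Longrightarrow> \<sigma> \<noteq> {}"
    and anti: "\<And>\<sigma> \<tau>. \<sigma> \<in> C \<Longrightarrow> \<tau> \<in> C \<Longrightarrow> \<sigma> \<subseteq> \<tau> \<Longrightarrow> \<sigma> = \<tau>"
  shows "maximal_cells {F. F \<noteq> {} \<and> (\<exists>\<sigma>\<in>C. F face_of \<sigma>)} = C" (is "maximal_cells ?\<Sigma> = C")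
proof -
  have sub: "C \<subseteq> ?\<Sigma>"
    using assms(1,2) face_of_refl polyhedron_imp_convex by blast
  show ?thesis
  proof (intro equalityI subsetI)
    fix F assume F: "F \<in> maximal_cells ?\<Sigma>"
    then obtain \<sigma> where \<sigma>: "\<sigma> \<in> C" "F face_of \<sigma>" unfolding maximal_cells_def by auto
    have "\<sigma> \<in> ?\<Sigma>" "F \<subseteq> \<sigma>" using sub \<sigma>(1) face_of_imp_subset[OF \<sigma>(2)] by auto
    then have "\<sigma> = F" using F unfolding maximal_cells_def by simp
    then show "F \<in> C" using \<sigma> by simp
  next
    fix \<sigma> assume \<sigma>: "\<sigma> \<in> C"
    have "\<tau> = \<sigma>" if \<tau>: "\<tau> \<in> ?\<Sigma>" "\<sigma> \<subseteq> \<tau>" for \<tau>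
    proof -
      obtain \<rho> where \<rho>: "\<rho> \<in> C" "\<tau> \<subseteq> \<rho>" using \<tau>(1) face_of_imp_subset by blast
      then have "\<sigma> = \<rho>" using anti[OF \<sigma> \<rho>(1)] \<tau>(2) by blast
      then show ?thesis using \<rho> \<tau>(2) by blast
    qed
    moreover have "\<sigma> \<in> ?\<Sigma>" using \<sigma> sub by auto
    ultimately show "\<sigma> \<in> maximal_cells ?\<Sigma>" unfolding maximal_cells_def by simp
  qed
qed

section \<open>Local structure and coarseness\<close>

text \<open>Only a short open segment starting at \<open>x\<close> is tested, so this depends only
  on the germ of \<open>S\<close> at \<open>x\<close>.\<close>

definition directions_into :: "'a::real_vector set \<Rightarrow> 'a \<Rightarrow> 'a set" where
  "directions_into S x = {h. \<exists>e>0. \<forall>t\<in>{0<..<e}. x + t *\<^sub>R h \<in> S}"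

text \<open>A small segment from \<open>x\<close> in direction \<open>h\<close> lies in one cell
  \<open>\<tau>\<close> containing \<open>x\<close>. As \<open>\<sigma> \<inter> \<tau>\<close> is a
  face of \<open>\<sigma>\<close> that meets the relative interior, \<open>\<tau>\<close> contains
  all of \<open>\<sigma>\<close>, and convexity carries the segment from \<open>x\<close> to
  \<open>y\<close>. Exchanging \<open>x\<close> and \<open>y\<close> gives the equality.\<close>

lemma directions_into_rel_interior_subset:
  fixes \<Sigma> :: "'a::euclidean_space set set"
  assumes fan: "polyhedral_fan \<Sigma>" and \<sigma>: "\<sigma> \<in> \<Sigma>"
    and x: "x \<in> rel_interior \<sigma>" and y: "y \<in> rel_interior \<sigma>"
  shows "directions_into (\<Union>\<Sigma>) x \<subseteq> directions_into (\<Union>\<Sigma>) y"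
proof
  fix h assume "h \<in> directions_into (\<Union>\<Sigma>) x"
  then obtain e where e: "e > 0" "\<And>t. t \<in> {0<..<e} \<Longrightarrow> x + t *\<^sub>R h \<in> \<Union>\<Sigma>"
    unfolding directions_into_def mem_Collect_eq by metis
  note fan' = fan[unfolded polyhedral_fan_def]
  have fin: "finite \<Sigma>" using fan' by (rule conjunct1)
  have poly: "polyhedron \<tau>" if "\<tau> \<in> \<Sigma>" for \<tau>
    using bspec[OF fan'[THEN conjunct2, THEN conjunct1] that] by (rule conjunct1)
  have face: "(\<sigma> \<inter> \<tau>) face_of \<sigma>" if "\<tau> \<in> \<Sigma>" for \<tau>
    using bspec[OF bspec[OF fan'[THEN conjunct2, THEN conjunct2, THEN conjunct2] \<sigma>] that]
    by (rule conjunct1)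
  have pos: "\<forall>\<^sub>F t in at_right 0. t \<in> {0<..<e}"
    using e(1) by (intro eventually_at_rightI[of 0 e]) auto
  then have "\<forall>\<^sub>F t in at_right 0. \<exists>\<tau>\<in>\<Sigma>. x + t *\<^sub>R h \<in> \<tau>"
    by eventually_elim (use e(2) in blast)
  \<comment> \<open>Membership for arbitrarily small \<open>t\<close> is the form in which the
    pigeonhole over finitely many cells applies; closedness and convexity of the chosen cell then
    give all small \<open>t\<close>.\<close>
  then have "\<exists>\<^sub>F t in at_right 0. \<exists>\<tau>\<in>\<Sigma>. x + t *\<^sub>R h \<in> \<tau>"
    by (rule eventually_frequently[rotated]) (simp add: trivial_limit_at_right_real)
  from frequently_bex_finite[OF fin this]
  obtain \<tau> where \<tau>: "\<tau> \<in> \<Sigma>" "\<exists>\<^sub>F t in at_right 0. x + t *\<^sub>R h \<in> \<tau>"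
    by blast
  have "x \<in> \<tau>"
  proof (rule ccontr)
    assume "x \<notin> \<tau>"
    have "((\<lambda>t. x + t *\<^sub>R h) \<longlongrightarrow> x + 0 *\<^sub>R h) (at_right 0)"
      by (intro tendsto_intros)
    moreover have "open (- \<tau>)"
      using poly[OF \<tau>(1)] polyhedron_imp_closed by blast
    ultimately have "\<forall>\<^sub>F t in at_right 0. x + t *\<^sub>R h \<in> - \<tau>"
      using \<open>x \<notin> \<tau>\<close> by (intro topological_tendstoD) auto
    with \<tau>(2) show False by (simp add: frequently_def)
  qed
  obtain u where u: "u > 0" "x + u *\<^sub>R h \<in> \<tau>"
    using frequently_ex[OF frequently_eventually_conj[OF \<tau>(2) pos]] by auto
  have "\<sigma> \<subseteq> \<sigma> \<inter> \<tau>"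
    using subset_of_face_of[OF face[OF \<tau>(1)] order_refl] x \<open>x \<in> \<tau>\<close> rel_interior_subset by blast
  have conv: "convex \<sigma>" "convex \<tau>"
    using poly \<sigma> \<tau>(1) polyhedron_imp_convex by blast+
  \<comment> \<open>As \<open>y\<close> is a relative interior point, the segment from
    \<open>x\<close> to \<open>y\<close> can be prolonged beyond \<open>y\<close> inside
    \<open>\<sigma>\<close>; its end is \<open>w\<close> below.\<close>
  obtain m where m: "m > 1" "(1 - m) *\<^sub>R x + m *\<^sub>R y \<in> \<sigma>"
  proof -
    have "x \<in> affine hull \<sigma>" using x rel_interior_subset[of \<sigma>] hull_inc[of x \<sigma>] by auto
    then obtain m where "m > 1" "\<forall>e. e > 1 \<and> e \<le> m \<longrightarrow> (1 - e) *\<^sub>R x + e *\<^sub>R y \<in> \<sigma>"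
      using convex_rel_interior_if[OF conv(1) y] by blast
    then show thesis using that by simp
  qed
  define w where "w = (1 - m) *\<^sub>R x + m *\<^sub>R y"
  have w: "w \<in> \<tau>" using m(2) \<open>\<sigma> \<subseteq> \<sigma> \<inter> \<tau>\<close> by (auto simp: w_def)
  \<comment> \<open>The homothety with centre \<open>w\<close> and ratio \<open>d\<close> takes
    \<open>x\<close> to \<open>y\<close> and shortens displacements along \<open>h\<close> by
    \<open>d\<close>; hence the step \<open>t / d\<close> at \<open>x\<close> and the bound
    \<open>d * u\<close>.\<close>
  define d where "d = 1 - 1 / m"
  have d: "0 < d" "d < 1" using m(1) by (auto simp: d_def)
  have y_eq: "y = d *\<^sub>R x + (1 - d) *\<^sub>R w"
    using m(1) by (simp add: d_def w_def algebra_simps)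
  have "y + t *\<^sub>R h \<in> \<tau>" if t: "t \<in> {0<..<d * u}" for t
  proof -
    have "(1 - t / (d * u)) *\<^sub>R x + (t / (d * u)) *\<^sub>R (x + u *\<^sub>R h) \<in> \<tau>"
      using t d u \<open>x \<in> \<tau>\<close> by (intro convexD_alt conv(2)) auto
    also have "(1 - t / (d * u)) *\<^sub>R x + (t / (d * u)) *\<^sub>R (x + u *\<^sub>R h) = x + (t / d) *\<^sub>R h"
      using u d by (simp add: algebra_simps)
    finally have "d *\<^sub>R (x + (t / d) *\<^sub>R h) + (1 - d) *\<^sub>R w \<in> \<tau>"
      using w d by (intro convexD[OF conv(2)]) auto
    then show ?thesis using d by (simp add: y_eq algebra_simps)
  qed
  then show "h \<in> directions_into (\<Union>\<Sigma>) y"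
    unfolding directions_into_def using \<tau>(1) d(1) u(1)
    by (intro CollectI exI[of _ "d * u"]) (auto intro!: bexI[of _ \<tau>])
qed

section \<open>The space near one of its points\<close>

definition minset :: "'m set \<Rightarrow> real ^ 'm \<Rightarrow> 'm set" where
  "minset S x = {i \<in> S. \<forall>r\<in>S. x $ i \<le> x $ r}"

lemma eventually_le_lex:
  fixes a b a' b' :: real
  shows "\<forall>\<^sub>F t in at_right 0. a + t * b \<le> a' + t * b' \<longleftrightarrow> a < a' \<or> a = a' \<and> b \<le> b'"
proof -
  have less: "\<forall>\<^sub>F t in at_right 0. a + t * b < a' + t * b'" if "a < a'" for a b a' b' :: real
  proof -
    have "((\<lambda>t. (a' + t * b') - (a + t * b)) \<longlongrightarrow> (a' + 0 * b') - (a + 0 * b)) (at_right 0)"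
      by (intro tendsto_intros)
    then have "\<forall>\<^sub>F t in at_right 0. (a' + t * b') - (a + t * b) > 0"
      using that by (intro order_tendstoD(1)[where y = "a' - a"]) auto
    then show ?thesis by eventually_elim simp
  qed
  consider "a < a'" | "a' < a" | "a = a'" by linarith
  then show ?thesis
  proof cases
    case 1
    then show ?thesis using less[OF 1, of b b'] by (auto elim: eventually_mono)
  next
    case 2
    then show ?thesis using less[OF 2, of b' b] by (auto elim!: eventually_mono)
  next
    case 3
    have "\<forall>\<^sub>F t in at_right (0::real). t > 0" by (simp add: eventually_at_right_less)
    then show ?thesis by eventually_elim (use 3 in auto)
  qed
qed

text \<open>This is the passage to initial forms: for small \<open>t\<close>, the minimum of
  \<open>x + t *\<^sub>R h\<close> over a set is attained where \<open>h\<close> is minimal among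
  the minimisers of \<open>x\<close>. There are finitely many comparisons, so one threshold
  \<open>d\<close> serves all of them.\<close>

lemma directions_into_double_min_space:
  "directions_into (double_min_space c) x = {h. \<forall>s. twice_min (minset {r. c r \<noteq> s} x) h}"
proof -
  have "h \<in> directions_into (double_min_space c) x \<longleftrightarrow> (\<forall>s. twice_min (minset {r. c r \<noteq> s} x) h)" for h
  proof -
    have "\<forall>\<^sub>F t in at_right 0. \<forall>i r. (x + t *\<^sub>R h) $ i \<le> (x + t *\<^sub>R h) $ r \<longleftrightarrow>
        x $ i < x $ r \<or> x $ i = x $ r \<and> h $ i \<le> h $ r"
      by (intro eventually_all_finite) (simp add: eventually_le_lex)
    then obtain d where d: "d > 0" "\<And>t i r. t \<in> {0<..<d} \<Longrightarrow> (x + t *\<^sub>R h) $ i \<le> (x + t *\<^sub>R h) $ r \<longleftrightarrow>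
        x $ i < x $ r \<or> x $ i = x $ r \<and> h $ i \<le> h $ r"
      unfolding eventually_at_right[OF zero_less_one] by force
    have key: "twice_min S (x + t *\<^sub>R h) \<longleftrightarrow> twice_min (minset S x) h" if t: "t \<in> {0<..<d}" for t S
    proof -
      have "(\<forall>r\<in>S. (x + t *\<^sub>R h) $ i \<le> (x + t *\<^sub>R h) $ r) \<longleftrightarrow>
          i \<in> minset S x \<and> (\<forall>r\<in>minset S x. h $ i \<le> h $ r)" if "i \<in> S" for i
        unfolding d(2)[OF t] minset_def using that by (auto; force)
      then show ?thesis
        unfolding twice_min_def minset_def by (smt (verit) mem_Collect_eq)
    qed
    show ?thesis
    proof
      assume "h \<in> directions_into (double_min_space c) x"
      then obtain e where e: "e > 0" "\<And>t. t \<in> {0<..<e} \<Longrightarrow> x + t *\<^sub>R h \<in> double_min_space c"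
        unfolding directions_into_def mem_Collect_eq by metis
      \<comment> \<open>\<open>key\<close> is an equivalence for each single \<open>t\<close> below
        \<open>d\<close>, so one admissible step already decides membership.\<close>
      define t where "t = min d e / 2"
      have "t \<in> {0<..<d}" "t \<in> {0<..<e}" using d(1) e(1) by (auto simp: t_def min_def)
      then show "\<forall>s. twice_min (minset {r. c r \<noteq> s} x) h"
        using key e(2)[of t] unfolding double_min_space_def by auto
    next
      assume "\<forall>s. twice_min (minset {r. c r \<noteq> s} x) h"
      then show "h \<in> directions_into (double_min_space c) x"
        unfolding directions_into_def double_min_space_def using d(1) key by auto
    qed
  qed
  then show ?thesis by blast
qed

lemma minset_eqI:
  assumes "S \<subseteq> S'" "r \<in> minset S' x" "r \<in> S"
  shows "minset S x = minset S' x \<inter> S"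
  using assms unfolding minset_def by (auto intro: order_trans)

lemma minset_nonempty:
  fixes x :: "real ^ 'm::finite"
  assumes "S \<noteq> {}" shows "minset S x \<noteq> {}"
proof -
  obtain i where "i \<in> S" "\<And>r. r \<in> S \<Longrightarrow> x $ i \<le> x $ r"
    using arg_min_if_finite[of S "\<lambda>r. x $ r"] assms by (metis finite_code not_le)
  then show ?thesis unfolding minset_def by blast
qed

lemma twice_min_pair_in_minset:
  assumes "twice_min S x"
  obtains i j where "i \<noteq> j" "i \<in> minset S x" "j \<in> minset S x"
  using assms unfolding twice_min_def minset_def by blast

text \<open>
  Near a point whose minimum does not meet three colours, the space is a product of two conditions
  \<open>twice_min A\<close> and \<open>twice_min B\<close>; if \<open>A\<close> and \<open>B\<close> lie on the same level, both are monochromatic.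
\<close>

definition two_block :: "('m::finite \<Rightarrow> nat) \<Rightarrow> real ^ 'm \<Rightarrow> nat \<Rightarrow> 'm set \<Rightarrow> 'm set \<Rightarrow> bool" where
  "two_block c x s A B \<longleftrightarrow>
     A = {r \<in> minset UNIV x. c r = s} \<and> B = minset {r. c r \<noteq> s} x \<and>
     (\<exists>i\<in>A. \<exists>j\<in>A. i \<noteq> j) \<and> (\<exists>k\<in>B. \<exists>l\<in>B. k \<noteq> l) \<and>
     (\<forall>k\<in>B. \<forall>l\<in>B. k \<in> minset UNIV x \<longrightarrow> c k = c l)"

lemma two_blockD:
  assumes "two_block c x s A B"
  shows "A = {r \<in> minset UNIV x. c r = s}" "B = minset {r. c r \<noteq> s} x"
    "\<exists>i\<in>A. \<exists>j\<in>A. i \<noteq> j" "\<exists>k\<in>B. \<exists>l\<in>B. k \<noteq> l"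
    "\<forall>k\<in>B. \<forall>l\<in>B. k \<in> minset UNIV x \<longrightarrow> c k = c l"
proof -
  note D = assms[unfolded two_block_def]
  show "A = {r \<in> minset UNIV x. c r = s}" by (rule D[THEN conjunct1])
  show "B = minset {r. c r \<noteq> s} x" by (rule D[THEN conjunct2, THEN conjunct1])
  show "\<exists>i\<in>A. \<exists>j\<in>A. i \<noteq> j" by (rule D[THEN conjunct2, THEN conjunct2, THEN conjunct1])
  show "\<exists>k\<in>B. \<exists>l\<in>B. k \<noteq> l"
    by (rule D[THEN conjunct2, THEN conjunct2, THEN conjunct2, THEN conjunct1])
  show "\<forall>k\<in>B. \<forall>l\<in>B. k \<in> minset UNIV x \<longrightarrow> c k = c l"
    by (rule D[THEN conjunct2, THEN conjunct2, THEN conjunct2, THEN conjunct2])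
qed

lemma two_block_colours:
  assumes "two_block c x s A B"
  shows "r \<in> A \<Longrightarrow> c r = s" "r \<in> B \<Longrightarrow> c r \<noteq> s"
  unfolding two_blockD(1,2)[OF assms] minset_def by auto

text \<open>Without three colours at the minimum, take a minimiser \<open>a\<close>, the minimisers
  of its colour as \<open>A\<close>, and the minimisers off its colour as \<open>B\<close>. The
  condition for \<open>c a\<close> gives two elements of \<open>B\<close>. If \<open>B\<close> meets
  the overall minimum it lies there entirely, and a second colour in \<open>B\<close> would complete
  three.\<close>

lemma double_min_space_cases:
  assumes x: "x \<in> double_min_space c"
  obtains i j k where "rainbow c i j k" "{i, j, k} \<subseteq> minset UNIV x"
    | s A B where "two_block c x s A B"
proof (cases "\<exists>i j k. rainbow c i j k \<and> {i, j, k} \<subseteq> minset UNIV x")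
  case True
  then show ?thesis using that(1) by blast
next
  case False
  let ?M = "minset UNIV x"
  have tw: "twice_min {r. c r \<noteq> s} x" for s
    using x by (simp add: double_min_space_def)
  obtain a where a: "a \<in> ?M" using minset_nonempty[of UNIV x] by auto
  have M: "minset {r. c r \<noteq> s} x = ?M \<inter> {r. c r \<noteq> s}" if "r \<in> ?M" "c r \<noteq> s" for r s
    using minset_eqI[of "{r. c r \<noteq> s}" UNIV r x] that by auto
  define A where "A = {r \<in> ?M. c r = c a}"
  define B where "B = minset {r. c r \<noteq> c a} x"
  have B2: "\<exists>k\<in>B. \<exists>l\<in>B. k \<noteq> l"
    using twice_min_pair_in_minset[OF tw[of "c a"]] unfolding B_def by metis
  have single: "c k = c l" if k: "k \<in> B" "l \<in> B" "k \<in> ?M" for k l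
  proof -
    have "c k \<noteq> c a" "c l \<noteq> c a" using k unfolding B_def minset_def by auto
    moreover have "l \<in> ?M" using M[OF k(3)] k(2) \<open>c k \<noteq> c a\<close> unfolding B_def by blast
    ultimately show ?thesis using False a k(3) unfolding rainbow_def by force
  qed
  have "\<exists>i\<in>A. \<exists>j\<in>A. i \<noteq> j"
  proof -
    \<comment> \<open>To get two elements of \<open>A\<close>, remove the only other colour that the
      minimum can meet; if there is none, remove any colour other than \<open>c a\<close>, for which
      \<open>Suc (c a)\<close> serves.\<close>
    obtain s where s: "c a \<noteq> s" "\<And>r. r \<in> ?M \<Longrightarrow> c r \<noteq> s \<Longrightarrow> c r = c a"
    proof (cases "\<exists>b\<in>?M. c b \<noteq> c a")
      case True
      then obtain b where b: "b \<in> ?M" "c b \<noteq> c a" by blast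
      show ?thesis
      proof (rule that[of "c b"])
        fix r assume "r \<in> ?M" "c r \<noteq> c b"
        then show "c r = c a" using False a b unfolding rainbow_def by force
      qed (use b in auto)
    next
      case False
      then show ?thesis by (intro that[of "Suc (c a)"]) auto
    qed
    obtain i j where "i \<noteq> j" "i \<in> ?M \<inter> {r. c r \<noteq> s}" "j \<in> ?M \<inter> {r. c r \<noteq> s}"
      using twice_min_pair_in_minset[OF tw[of s]] M[OF a s(1)] by metis
    then show ?thesis using s(2) unfolding A_def by blast
  qed
  then have "two_block c x (c a) A B"
    unfolding two_block_def using A_def B_def B2 single by blast
  then show ?thesis by (rule that(2))
qed

text \<open>No single removed colour exhausts the overall minimisers, so the level of the minimum
  never rises.\<close>

lemma directions_rainbow:
  assumes "rainbow c i j k" "{i, j, k} \<subseteq> minset UNIV x"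
  shows "h \<in> directions_into (double_min_space c) x \<longleftrightarrow>
    (\<forall>s. twice_min {r \<in> minset UNIV x. c r \<noteq> s} h)"
proof -
  have "minset {r. c r \<noteq> s} x = {r \<in> minset UNIV x. c r \<noteq> s}" for s
  proof -
    obtain r where "r \<in> {i, j, k}" "c r \<noteq> s"
      using assms(1) unfolding rainbow_def by (metis insertCI)
    then show ?thesis
      using minset_eqI[of "{r. c r \<noteq> s}" UNIV r x] assms(2) by auto
  qed
  then show ?thesis by (simp add: directions_into_double_min_space)
qed

lemma twice_min_Un:
  assumes "twice_min A h" "twice_min B h" shows "twice_min (A \<union> B) h"
proof -
  obtain i j k l where ij: "i \<in> A" "j \<in> A" "i \<noteq> j" "\<forall>r\<in>A. h $ i \<le> h $ r \<and> h $ j \<le> h $ r"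
    and kl: "k \<in> B" "l \<in> B" "k \<noteq> l" "\<forall>r\<in>B. h $ k \<le> h $ r \<and> h $ l \<le> h $ r"
    using assms unfolding twice_min_def by blast
  show ?thesis
  proof (cases "h $ i \<le> h $ k")
    case True
    then have "\<forall>r\<in>A \<union> B. h $ i \<le> h $ r \<and> h $ j \<le> h $ r" using ij kl by (meson UnE order_trans)
    then show ?thesis unfolding twice_min_def using ij by blast
  next
    case False
    then have "\<forall>r\<in>A \<union> B. h $ k \<le> h $ r \<and> h $ l \<le> h $ r"
      using ij kl by (meson UnE order_trans linear)
    then show ?thesis unfolding twice_min_def using kl by blast
  qed
qed

text \<open>Removing the colour \<open>s\<close> of \<open>A\<close> leaves the minimisers
  \<open>B\<close>; removing another colour leaves \<open>A\<close> or \<open>A \<union> B\<close>.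
  The condition on the union follows from those on the two parts, since the part with the lower
  minimum decides.\<close>

lemma directions_two_block:
  assumes "two_block c x s A B"
  shows "h \<in> directions_into (double_min_space c) x \<longleftrightarrow> twice_min A h \<and> twice_min B h"
proof -
  let ?M = "minset UNIV x"
  have A: "A = {r \<in> ?M. c r = s}" and B: "B = minset {r. c r \<noteq> s} x"
    and single: "\<And>k l. k \<in> B \<Longrightarrow> l \<in> B \<Longrightarrow> k \<in> ?M \<Longrightarrow> c k = c l"
    using two_blockD[OF assms] by blast+
  obtain a where a: "a \<in> ?M" "c a = s" using two_blockD(1,3)[OF assms] by blast
  obtain b where b: "b \<in> B" using two_blockD(4)[OF assms] by blast
  then have bs: "c b \<noteq> s" unfolding B minset_def by simp
  have M: "minset {r. c r \<noteq> s'} x = {r \<in> ?M. c r \<noteq> s'}" if "r \<in> ?M" "c r \<noteq> s'" for r s'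
    using minset_eqI[of "{r. c r \<noteq> s'}" UNIV r x] that by auto
  have B_M: "r \<in> B" if "r \<in> ?M" "c r \<noteq> s" for r using M[OF that] that B by blast
  have cases_M: "{r \<in> ?M. c r \<noteq> s'} = A \<or> {r \<in> ?M. c r \<noteq> s'} = A \<union> B" if "s' \<noteq> s" for s'
  proof (cases "\<exists>r\<in>?M. c r \<noteq> s \<and> c r \<noteq> s'")
    case True
    then obtain r where r: "r \<in> ?M" "c r \<noteq> s" "c r \<noteq> s'" by blast
    have col: "c q = c r" if "q \<in> B" for q using single[OF B_M[OF r(1,2)] that r(1)] by simp
    have sub: "B \<subseteq> ?M" using M[OF r(1,2)] B by blast
    have "q \<in> ?M \<and> c q \<noteq> s' \<longleftrightarrow> q \<in> A \<union> B" for q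
    proof (cases "c q = s")
      case True
      then have "q \<notin> B" using B by (auto simp: minset_def)
      then show ?thesis using True that A by auto
    next
      case False
      then have "q \<notin> A" "q \<in> ?M \<longleftrightarrow> q \<in> B" using A B_M[of q] sub by auto
      then show ?thesis using col[of q] r(3) by auto
    qed
    then show ?thesis by blast
  next
    case False
    then have "{r \<in> ?M. c r \<noteq> s'} = A" using that unfolding A by auto
    then show ?thesis ..
  qed
  \<comment> \<open>The condition on \<open>A\<close> alone occurs: the colour of an element
    \<open>b\<close> of \<open>B\<close> works, because the alternative \<open>A \<union> B\<close>
    would contain \<open>b\<close>.\<close>
  obtain t where t: "t \<noteq> s" "{r \<in> ?M. c r \<noteq> t} = A"
  proof -
    have "{r \<in> ?M. c r \<noteq> c b} = A"
      using cases_M[OF bs] b by blast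
    then show ?thesis using that bs by blast
  qed
  show ?thesis
  proof
    assume "h \<in> directions_into (double_min_space c) x"
    then have "twice_min (minset {r. c r \<noteq> q} x) h" for q by (simp add: directions_into_double_min_space)
    from this[of t] this[of s] show "twice_min A h \<and> twice_min B h"
      using M[of a t] a t B by auto
  next
    assume h: "twice_min A h \<and> twice_min B h"
    have "twice_min (minset {r. c r \<noteq> q} x) h" for q
    proof (cases "q = s")
      case False
      then show ?thesis using M[of a q] a cases_M[OF False] h twice_min_Un by auto
    qed (use h B in simp)
    then show "h \<in> directions_into (double_min_space c) x" by (simp add: directions_into_double_min_space)
  qed
qed

section \<open>Recovering the local structure from test vectors\<close>

lemma twice_min_unit_off:
  "twice_min N (unit_off S)" if "i \<in> N \<inter> S" "j \<in> N \<inter> S" "i \<noteq> j" for i j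
  using that unfolding twice_min_def by (intro bexI[of _ i] bexI[of _ j]) auto

lemma twice_min_unit_off_disjoint:
  "twice_min N (unit_off S)" if "i \<in> N" "j \<in> N" "i \<noteq> j" "N \<inter> S = {}" for i j
proof -
  have "r \<notin> S" if "r \<in> N" for r using that \<open>N \<inter> S = {}\<close> by blast
  then show ?thesis using that unfolding twice_min_def by (intro bexI[of _ i] bexI[of _ j]) auto
qed

text \<open>A single zero on \<open>N\<close> is the only obstruction used below: two zeros give a
  repeated minimum, and without zeros the vector is constant on \<open>N\<close>.\<close>

lemma not_twice_min_unit_off:
  assumes "N \<inter> S = {i}" shows "\<not> twice_min N (unit_off S)"
proof
  assume "twice_min N (unit_off S)"
  then obtain a b where ab: "a \<in> N" "b \<in> N" "a \<noteq> b" "\<forall>r\<in>N. unit_off S $ a \<le> (unit_off S $ r :: real) \<and>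
      unit_off S $ b \<le> (unit_off S $ r :: real)"
    unfolding twice_min_def by blast
  have "i \<in> N" "i \<in> S" using assms by auto
  then have "a \<in> N \<inter> S" "b \<in> N \<inter> S" using ab by (auto split: if_splits)
  then show False using ab(3) unfolding assms by blast
qed

lemma minset_UNIV_iff: "i \<in> minset UNIV x \<longleftrightarrow> (\<forall>r. x $ i \<le> x $ r)"
  by (simp add: minset_def)

lemma minset_eq_nth: "i \<in> minset S x \<Longrightarrow> j \<in> minset S x \<Longrightarrow> x $ i = x $ j"
  unfolding minset_def by (auto intro: antisym)

lemma rainbow_unit_off:
  assumes M: "rainbow c i j k" "{i, j, k} \<subseteq> minset UNIV x"
  shows "unit_off {r} \<in> directions_into (double_min_space c) x \<longleftrightarrow> r \<notin> minset UNIV x"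
    and "r \<in> minset UNIV x \<Longrightarrow> t \<in> minset UNIV x \<Longrightarrow> c r \<noteq> c t \<Longrightarrow>
      unit_off {r, t} \<notin> directions_into (double_min_space c) x"
proof -
  have two: "\<exists>a b. a \<in> minset UNIV x \<and> b \<in> minset UNIV x \<and> c a \<noteq> s \<and> c b \<noteq> s \<and> a \<noteq> b" for s
    using M unfolding rainbow_def by (metis insert_subset)
  show "unit_off {r} \<in> directions_into (double_min_space c) x \<longleftrightarrow> r \<notin> minset UNIV x"
  proof
    assume h: "unit_off {r} \<in> directions_into (double_min_space c) x"
    show "r \<notin> minset UNIV x"
    proof
      assume "r \<in> minset UNIV x"
      \<comment> \<open>\<open>Suc (c r)\<close> merely stands for a colour other than that of
        \<open>r\<close>, so that \<open>r\<close> is kept.\<close>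
      then have "{q \<in> minset UNIV x. c q \<noteq> Suc (c r)} \<inter> {r} = {r}" by auto
      from not_twice_min_unit_off[OF this] show False using h unfolding directions_rainbow[OF M] by blast
    qed
  next
    assume r: "r \<notin> minset UNIV x"
    have "twice_min {q \<in> minset UNIV x. c q \<noteq> s} (unit_off {r})" for s
      using two[of s] twice_min_unit_off_disjoint[of _ "{q \<in> minset UNIV x. c q \<noteq> s}" _ "{r}"] r by blast
    then show "unit_off {r} \<in> directions_into (double_min_space c) x"
      unfolding directions_rainbow[OF M] by blast
  qed
  assume "r \<in> minset UNIV x" "t \<in> minset UNIV x" "c r \<noteq> c t"
  then have "{q \<in> minset UNIV x. c q \<noteq> c r} \<inter> {r, t} = {t}" by auto
  from not_twice_min_unit_off[OF this]
  show "unit_off {r, t} \<notin> directions_into (double_min_space c) x"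
    unfolding directions_rainbow[OF M] by blast
qed

text \<open>A block containing exactly one zero rejects the vector. Two zeros in one block leave the
  other block constant, whereas two zeros in different blocks spoil both.\<close>

lemma two_block_unit_off:
  assumes "two_block c x s A B"
  shows "unit_off {r} \<in> directions_into (double_min_space c) x \<longleftrightarrow> r \<notin> A \<union> B"
    and "r \<in> A \<union> B \<Longrightarrow> t \<in> A \<union> B \<Longrightarrow> r \<noteq> t \<Longrightarrow>
      unit_off {r, t} \<in> directions_into (double_min_space c) x \<longleftrightarrow> (r \<in> A \<longleftrightarrow> t \<in> A)"
proof -
  have disj: "A \<inter> B = {}" using two_block_colours[OF assms] by blast
  obtain i j k l where A: "i \<in> A" "j \<in> A" "i \<noteq> j" and B: "k \<in> B" "l \<in> B" "k \<noteq> l"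
    using two_blockD(3,4)[OF assms] by blast
  have A2: "twice_min A (unit_off S)" if "A \<inter> S = {}" for S
    using twice_min_unit_off_disjoint[OF A that] .
  have B2: "twice_min B (unit_off S)" if "B \<inter> S = {}" for S
    using twice_min_unit_off_disjoint[OF B that] .
  note iff = directions_two_block[OF assms]
  show "unit_off {r} \<in> directions_into (double_min_space c) x \<longleftrightarrow> r \<notin> A \<union> B"
    unfolding iff using A2[of "{r}"] B2[of "{r}"] not_twice_min_unit_off[of A "{r}" r]
      not_twice_min_unit_off[of B "{r}" r] by blast
  assume rt: "r \<in> A \<union> B" "t \<in> A \<union> B" "r \<noteq> t"
  consider "r \<in> A" "t \<in> A" | "r \<in> A" "t \<in> B" | "r \<in> B" "t \<in> A" | "r \<in> B" "t \<in> B" using rt by blast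
  then show "unit_off {r, t} \<in> directions_into (double_min_space c) x \<longleftrightarrow> (r \<in> A \<longleftrightarrow> t \<in> A)"
  proof cases
    case 1
    then have "B \<inter> {r, t} = {}" using disj by blast
    then show ?thesis unfolding iff using 1 B2 twice_min_unit_off[of r A "{r, t}" t] rt by auto
  next
    case 2
    then have "A \<inter> {r, t} = {r}" using disj by blast
    then show ?thesis unfolding iff using 2 not_twice_min_unit_off disj by blast
  next
    case 3
    then have "A \<inter> {r, t} = {t}" using disj by blast
    then show ?thesis unfolding iff using 3 not_twice_min_unit_off disj by blast
  next
    case 4
    then have "A \<inter> {r, t} = {}" using disj by blast
    then show ?thesis unfolding iff using 4 A2 twice_min_unit_off[of r B "{r, t}" t] rt disj by auto
  qed
qed

text \<open>Both orders are stated because test vectors do not reveal which of the two blocks is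
  \<open>A\<close>.\<close>

lemma two_block_in_pair_cell:
  assumes "two_block c x s A B" "i \<in> A" "j \<in> A" "k \<in> B" "l \<in> B"
  shows "x \<in> pair_cell c i j k l" "x \<in> pair_cell c k l i j"
proof -
  have A: "i \<in> minset UNIV x" "j \<in> minset UNIV x" "c i = s" "c j = s"
    and B: "k \<in> minset {r. c r \<noteq> s} x" "l \<in> minset {r. c r \<noteq> s} x"
    using two_blockD(1,2)[OF assms(1)] assms(2-) by blast+
  show "x \<in> pair_cell c i j k l" "x \<in> pair_cell c k l i j"
    using minset_eq_nth[OF A(1,2)] minset_eq_nth[OF B] A B unfolding pair_cell_def by (auto simp: minset_def)
qed

text \<open>The cone is read off from the local structure at \<open>x\<close>; every point with the
  same directions is then shown to satisfy its inequalities. Taking \<open>y = x\<close> gives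
  membership of \<open>x\<close> itself.\<close>

lemma double_min_space_cell:
  assumes x: "x \<in> double_min_space c"
  obtains \<sigma> where "\<sigma> \<in> cells c" "x \<in> \<sigma>"
    "\<And>y. y \<in> double_min_space c \<Longrightarrow>
      directions_into (double_min_space c) y = directions_into (double_min_space c) x \<Longrightarrow> y \<in> \<sigma>"
proof -
  let ?D = "directions_into (double_min_space c)"
  have "\<exists>\<sigma>\<in>cells c. \<forall>y\<in>double_min_space c. ?D y = ?D x \<longrightarrow> y \<in> \<sigma>"
    using x
  proof (cases rule: double_min_space_cases)
    case 1: (1 i j k)
    have "y \<in> triple_cell i j k" if y: "y \<in> double_min_space c" "?D y = ?D x" for y
    proof -
      have off: "unit_off {r} \<notin> ?D y" "\<And>t. c r \<noteq> c t \<Longrightarrow> t \<in> {i, j, k} \<Longrightarrow> unit_off {r, t} \<notin> ?D y"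
        if "r \<in> {i, j, k}" for r
        unfolding y(2) using rainbow_unit_off[OF 1] that 1(2) by blast+
      from y(1) show ?thesis
      proof (cases rule: double_min_space_cases)
        case Y: (1 i' j' k')
        have "r \<in> minset UNIV y" if "r \<in> {i, j, k}" for r
          using off(1)[OF that] rainbow_unit_off(1)[OF Y, of r] by blast
        then have "i \<in> minset UNIV y" "j \<in> minset UNIV y" "k \<in> minset UNIV y" by simp_all
        then show ?thesis
          unfolding triple_cell_def minset_UNIV_iff by (auto intro: antisym)
      next
        case Y: (2 s A B)
        have "r \<in> A \<union> B" if "r \<in> {i, j, k}" for r using off(1)[OF that] two_block_unit_off(1)[OF Y] by blast
        \<comment> \<open>Three indices would have to lie pairwise in different blocks, but there
          are only two blocks.\<close>
        then have "r \<in> A \<longleftrightarrow> t \<notin> A" if "r \<in> {i, j, k}" "t \<in> {i, j, k}" "c r \<noteq> c t" for r t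
          using off(2)[OF that(1,3,2)] two_block_unit_off(2)[OF Y, of r t] that by blast
        from this[of i j] this[of i k] this[of j k] show ?thesis using 1(1) unfolding rainbow_def by simp
      qed
    qed
    moreover have "triple_cell i j k \<in> cells c" using 1(1) unfolding cells_def by blast
    ultimately show ?thesis by blast
  next
    case 2: (2 s A B)
    obtain i j k l where ij: "i \<in> A" "j \<in> A" "i \<noteq> j" and kl: "k \<in> B" "l \<in> B" "k \<noteq> l"
      using two_blockD(3,4)[OF 2] by blast
    have c: "c i = s" "c j = s" "c k \<noteq> s" "c l \<noteq> s" "k \<notin> A" "l \<notin> A"
      using two_block_colours[OF 2] ij kl by blast+
    have "y \<in> pair_cell c i j k l" if y: "y \<in> double_min_space c" "?D y = ?D x" for y
    proof -
      have off: "unit_off {r} \<notin> ?D y" if "r \<in> {i, j, k, l}" for r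
        unfolding y(2) using two_block_unit_off(1)[OF 2] that ij kl by blast
      have off2: "unit_off {i, j} \<in> ?D y" "unit_off {k, l} \<in> ?D y" "unit_off {i, k} \<notin> ?D y"
        unfolding y(2) using two_block_unit_off(2)[OF 2] ij kl c by auto
      from y(1) show ?thesis
      proof (cases rule: double_min_space_cases)
        case Y: (1 i' j' k')
        \<comment> \<open>No contradiction is sought here: if all four indices attain the overall
          minimum of \<open>y\<close>, the inequalities of the cone hold anyway.\<close>
        have "r \<in> minset UNIV y" if "r \<in> {i, j, k, l}" for r
          using off[OF that] rainbow_unit_off(1)[OF Y, of r] by blast
        then have "i \<in> minset UNIV y" "j \<in> minset UNIV y" "k \<in> minset UNIV y" "l \<in> minset UNIV y"
          by simp_all
        then show ?thesis
          unfolding pair_cell_def minset_UNIV_iff by (auto intro: antisym)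
      next
        case Y: (2 s' A' B')
        have "r \<in> A' \<union> B'" if "r \<in> {i, j, k, l}" for r using off[OF that] two_block_unit_off(1)[OF Y] by blast
        then have U: "i \<in> A' \<union> B'" "j \<in> A' \<union> B'" "k \<in> A' \<union> B'" "l \<in> A' \<union> B'" by auto
        have "i \<in> A' \<longleftrightarrow> j \<in> A'" "k \<in> A' \<longleftrightarrow> l \<in> A'" "i \<in> A' \<longleftrightarrow> k \<notin> A'"
          using two_block_unit_off(2)[OF Y, of i j] two_block_unit_off(2)[OF Y, of k l]
            two_block_unit_off(2)[OF Y, of i k] off2 U ij kl c by auto
        then show ?thesis using U two_block_in_pair_cell[OF Y] by blast
      qed
    qed
    moreover have "paired c i j k l" using ij kl c by (simp add: paired_def)
    then have "pair_cell c i j k l \<in> cells c" unfolding cells_def by blast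
    ultimately show ?thesis by blast
  qed
  then show ?thesis using that x by blast
qed

lemma Union_cells: "\<Union> (cells c) = double_min_space c"
proof
  show "\<Union> (cells c) \<subseteq> double_min_space c"
    using triple_cell_subset pair_cell_subset by (force elim: cells_cases)
  show "double_min_space c \<subseteq> \<Union> (cells c)"
    using double_min_space_cell by blast
qed

lemma coarsest_fan_on_double_min_space:
  "coarsest_fan_on (double_min_space c) {F. F \<noteq> {} \<and> (\<exists>\<sigma>\<in>cells c. F face_of \<sigma>)}"
  (is "coarsest_fan_on ?H ?\<Sigma>")
  unfolding coarsest_fan_on_def
proof (intro conjI allI impI ballI)
  show "polyhedral_fan ?\<Sigma>"
    by (intro polyhedral_fan_faces finite_cells cells_polyhedron cells_cone cells_Int_face)
  have cells: "\<sigma> \<in> ?\<Sigma>" if "\<sigma> \<in> cells c" for \<sigma>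
    using cells_cone(2)[OF that] face_of_refl[OF polyhedron_imp_convex[OF cells_polyhedron[OF that]]] that
    by blast
  have "\<Union>?\<Sigma> = \<Union> (cells c)"
  proof (intro equalityI Union_least)
    fix F assume "F \<in> ?\<Sigma>"
    then obtain \<sigma> where "\<sigma> \<in> cells c" "F face_of \<sigma>" by blast
    then show "F \<subseteq> \<Union> (cells c)" using face_of_imp_subset[of F \<sigma>] by blast
  qed (use cells in blast)
  then show "\<Union>?\<Sigma> = ?H" by (simp add: Union_cells)
  fix \<Sigma>' and \<sigma>' :: "(real ^ 'a) set"
  assume fan: "polyhedral_fan \<Sigma>' \<and> \<Union>\<Sigma>' = ?H" and \<sigma>': "\<sigma>' \<in> \<Sigma>'"
  have "polyhedron \<sigma>' \<and> cone \<sigma>' \<and> \<sigma>' \<noteq> {}"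
    using bspec[OF fan[THEN conjunct1, unfolded polyhedral_fan_def, THEN conjunct2, THEN conjunct1] \<sigma>'] .
  then have conv: "convex \<sigma>'" "\<sigma>' \<noteq> {}" using polyhedron_imp_convex by auto
  then obtain x where x: "x \<in> rel_interior \<sigma>'" using rel_interior_eq_empty by blast
  have sub: "rel_interior \<sigma>' \<subseteq> ?H" using rel_interior_subset fan \<sigma>' by blast
  obtain \<sigma> where \<sigma>: "\<sigma> \<in> cells c" "\<And>y. y \<in> ?H \<Longrightarrow> directions_into ?H y = directions_into ?H x \<Longrightarrow> y \<in> \<sigma>"
    using double_min_space_cell[of x c] sub x by blast
  have "directions_into ?H y = directions_into ?H x" if "y \<in> rel_interior \<sigma>'" for y
    using directions_into_rel_interior_subset[of \<Sigma>' \<sigma>' x y]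
      directions_into_rel_interior_subset[of \<Sigma>' \<sigma>' y x] fan \<sigma>' x that by auto
  then have "rel_interior \<sigma>' \<subseteq> \<sigma>" using \<sigma>(2) sub by blast
  then have "closure (rel_interior \<sigma>') \<subseteq> \<sigma>"
    using polyhedron_imp_closed[OF cells_polyhedron[OF \<sigma>(1)]] by (rule closure_minimal)
  then have "\<sigma>' \<subseteq> \<sigma>" using convex_closure_rel_interior[OF conv(1)] closure_subset by blast
  then show "\<exists>\<sigma>\<in>?\<Sigma>. \<sigma>' \<subseteq> \<sigma>" using \<sigma>(1) cells by blast
qed

lemma maximal_cells_double_min_space:
  "maximal_cells {F. F \<noteq> {} \<and> (\<exists>\<sigma>\<in>cells c. F face_of \<sigma>)} = cells c"
  using cells_cone(2) by (intro maximal_cells_faces cells_polyhedron cells_antichain) auto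

section \<open>Realisation over the valued field\<close>

locale valued_field =
  fixes v :: "'k::alg_closed_field \<Rightarrow> real" and T :: "real set" and p :: nat
  assumes val: "valuation_into v T" and p: "prime p" and char: "CHAR('k) = p"
begin

lemma v_mult: "x \<noteq> 0 \<Longrightarrow> y \<noteq> 0 \<Longrightarrow> v (x * y) = v x + v y"
  using val unfolding valuation_into_def by blast

lemma v_add: "x \<noteq> 0 \<Longrightarrow> y \<noteq> 0 \<Longrightarrow> x + y \<noteq> 0 \<Longrightarrow> min (v x) (v y) \<le> v (x + y)"
  using val unfolding valuation_into_def by blast

lemma v_1 [simp]: "v 1 = 0"
  using v_mult[of 1 1] by simp

lemma v_minus [simp]: "v (- x) = v x"
proof (cases "x = 0")
  case False
  have "v (-1) = 0" using v_mult[of "-1" "-1"] by simp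
  then show ?thesis using v_mult[of "-1" x] False by simp
qed simp

lemma v_power: "x \<noteq> 0 \<Longrightarrow> v (x ^ k) = real k * v x"
  by (induction k) (simp_all add: v_mult algebra_simps)

lemma v_inverse: "x \<noteq> 0 \<Longrightarrow> v (inverse x) = - v x"
  using v_mult[of x "inverse x"] by simp

text \<open>The real number \<open>v 0\<close> is arbitrary, so the convention that 0 has infinite
  value is built in here.\<close>

definition above :: "real \<Rightarrow> 'k \<Rightarrow> bool" where
  "above m x \<longleftrightarrow> x = 0 \<or> m < v x"

lemma above_add: "above m x \<Longrightarrow> above m y \<Longrightarrow> above m (x + y)"
  unfolding above_def using v_add[of x y] by fastforce

lemma above_sum: "(\<And>r. r \<in> S \<Longrightarrow> above m (x r)) \<Longrightarrow> above m (sum x S)"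
  by (induction S rule: infinite_finite_induct) (auto intro: above_add, auto simp: above_def)

lemma v_add_above:
  assumes "x \<noteq> 0" "above (v x) y"
  shows "x + y \<noteq> 0" "v (x + y) = v x"
proof -
  show nz: "x + y \<noteq> 0"
  proof
    assume "x + y = 0"
    then have "y = - x" by (simp add: eq_neg_iff_add_eq_0 add.commute)
    then show False using assms unfolding above_def by simp
  qed
  show "v (x + y) = v x"
  proof (cases "y = 0")
    case False
    then have y: "v x < v y" using assms(2) by (simp add: above_def)
    have "v x \<le> v (x + y)" using v_add[OF assms(1) False nz] y by simp
    \<comment> \<open>Apply the ultrametric inequality to \<open>x = (x + y) + (- y)\<close>: as
      \<open>v y > v x\<close>, the term \<open>- y\<close> cannot provide the minimum.\<close>
    moreover have "v (x + y) \<le> v x"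
      using v_add[of "x + y" "- y"] nz False assms(1) y by auto
    ultimately show ?thesis by simp
  qed simp
qed

section \<open>Exponent differences in characteristic \<open>p\<close>\<close>

lemma v_of_nat:
  assumes "\<not> p dvd m"
  shows "(of_nat m :: 'k) \<noteq> 0" "v (of_nat m) = 0"
proof -
  have unit: "(of_nat k :: 'k) \<noteq> 0" "v (of_nat k) \<le> 0" if "\<not> p dvd k" for k
    using residue_char_eq[OF val char p, of k] that by auto
  have "coprime m p"
    using assms p prime_imp_coprime coprime_commute by blast
  then obtain k where k: "[m * k = 1] (mod p)"
    using cong_solve_coprime_nat by auto
  then have "\<not> p dvd k"
    using p by (metis cong_dvd_iff dvd_mult not_prime_unit)
  have "(of_nat m * of_nat k :: 'k) = 1"
    using k of_nat_eq_iff_cong_CHAR[where 'a = 'k, of "m * k" 1] char by simp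
  \<comment> \<open>Both values are at most 0 because the integers are prime to \<open>p\<close>;
    their sum is 0, so both vanish.\<close>
  then have "v (of_nat m) + v (of_nat k) = 0"
    using v_mult[OF unit(1)[OF assms] unit(1)[OF \<open>\<not> p dvd k\<close>]] by simp
  then show "(of_nat m :: 'k) \<noteq> 0" "v (of_nat m) = 0"
    using unit[OF assms] unit[OF \<open>\<not> p dvd k\<close>] by auto
qed

text \<open>Formed in the field, since subtraction of naturals would truncate.\<close>

definition diff :: "nat \<Rightarrow> nat \<Rightarrow> 'k" where
  "diff r s = of_nat r - of_nat s"

lemma diff_cong: "[r = s] (mod p) \<Longrightarrow> diff r s = 0"
  using of_nat_eq_iff_cong_CHAR[where 'a = 'k, of r s] char by (simp add: diff_def)

lemma diff_unit:
  assumes "\<not> [r = s] (mod p)"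
  shows "diff r s \<noteq> 0" "v (diff r s) = 0"
proof -
  show nz: "diff r s \<noteq> 0"
    using of_nat_eq_iff_cong_CHAR[where 'a = 'k, of r s] char assms by (simp add: diff_def)
  have less: "v (diff r s) = 0" if "s \<le> r" "\<not> [r = s] (mod p)" for r s
    using v_of_nat[of "r - s"] that cong_altdef_nat[of s r p] by (simp add: diff_def of_nat_diff cong_sym_eq)
  have "diff r s = - diff s r" by (simp add: diff_def)
  then show "v (diff r s) = 0"
    using less[of s r] less[of r s] assms by (metis cong_sym linear v_minus)
qed

lemma v_diff_mult: "\<not> [r = s] (mod p) \<Longrightarrow> x \<noteq> 0 \<Longrightarrow> v (diff r s * x) = v x"
  using v_mult diff_unit by simp

lemma above_diff_mult: "above m x \<Longrightarrow> above m (diff r s * x)"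
  using v_diff_mult[of r s x] diff_cong[of r s] by (cases "[r = s] (mod p)"; cases "x = 0") (auto simp: above_def)

section \<open>Cancellation, solving for a coefficient, and density of values\<close>

lemma sum_zero_twice_min:
  assumes "finite S" "S \<noteq> {}" "\<And>r. r \<in> S \<Longrightarrow> x r \<noteq> 0" "sum x S = 0"
  shows "\<exists>i\<in>S. \<exists>j\<in>S. i \<noteq> j \<and> (\<forall>r\<in>S. v (x i) \<le> v (x r) \<and> v (x j) \<le> v (x r))"
proof -
  obtain i where i: "i \<in> S" "\<And>r. r \<in> S \<Longrightarrow> v (x i) \<le> v (x r)"
    using arg_min_if_finite[OF assms(1,2), of "\<lambda>r. v (x r)"] by (metis not_le)
  have "\<exists>j\<in>S. j \<noteq> i \<and> v (x j) \<le> v (x i)"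
  proof (rule ccontr)
    assume "\<not> ?thesis"
    \<comment> \<open>A unique term of least value would dominate the others, and the sum could not
      be 0.\<close>
    then have "above (v (x i)) (sum x (S - {i}))"
      by (intro above_sum) (auto simp: above_def)
    from v_add_above(1)[OF assms(3)[OF i(1)] this] show False
      using assms(4) sum.remove[OF assms(1) i(1), of x] by simp
  qed
  then obtain j where "j \<in> S" "j \<noteq> i" "v (x j) \<le> v (x i)" by blast
  then have "\<forall>r\<in>S. v (x i) \<le> v (x r) \<and> v (x j) \<le> v (x r)" using i(2) by force
  then show ?thesis using i(1) \<open>j \<in> S\<close> \<open>j \<noteq> i\<close> by metis
qed

text \<open>The term \<open>u * x\<close> dominates \<open>R\<close>, and \<open>u\<close>,
  \<open>w\<close> have value 0, so the solution \<open>y\<close> is forced to have the value of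
  \<open>x\<close>.\<close>

lemma solve_two_terms:
  assumes u: "u \<noteq> 0" "v u = 0" and w: "w \<noteq> 0" "v w = 0"
    and x: "x \<noteq> 0" and R: "above (v x) R"
  obtains y where "y \<noteq> 0" "v y = v x" "u * x + w * y + R = 0"
proof
  let ?y = "- (inverse w * (u * x + R))"
  have ux: "u * x \<noteq> 0" "v (u * x) = v x" using u x v_mult by auto
  have "u * x + R \<noteq> 0" "v (u * x + R) = v x" using v_add_above[of "u * x" R] ux R by auto
  then show "?y \<noteq> 0" "v ?y = v x" using w v_mult[of "inverse w" "u * x + R"] v_inverse[of w] by auto
  show "u * x + w * ?y + R = 0" using w by (simp add: field_simps)
qed

text \<open>A root of high degree of an element of positive value has an arbitrarily small positive
  value; its integer powers have the multiples of that value.\<close>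

lemma value_dense:
  assumes "e > 0"
  obtains y where "y \<noteq> 0" "\<bar>v y - a\<bar> < e"
proof -
  obtain x where x: "x \<noteq> 0" "v x \<noteq> 0" using val unfolding valuation_into_def by blast
  define z where "z = (if v x > 0 then x else inverse x)"
  have z: "z \<noteq> 0" "v z > 0" using x v_inverse[of x] by (auto simp: z_def)
  obtain q :: nat where q: "v z / e < real q" using reals_Archimedean2 by blast
  then have "q > 0" using z assms by (cases q) (auto simp: divide_less_0_iff)
  then obtain w where w: "w ^ q = z" using nth_root_exists[of q z] by blast
  have "w \<noteq> 0" using w z \<open>q > 0\<close> by auto
  then have vw: "real q * v w = v z" using w v_power by metis
  then have "v w > 0" using z \<open>q > 0\<close> by (metis of_nat_0_less_iff zero_less_mult_pos)
  have "v w < e" using vw q assms \<open>q > 0\<close>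
    by (metis divide_less_eq mult.commute mult_less_cancel_left_pos of_nat_0_less_iff)
  define k where "k = \<lfloor>a / v w\<rfloor>"
  have k: "of_int k * v w \<le> a" "a < of_int k * v w + v w"
    using \<open>v w > 0\<close> floor_divide_lower[of "v w" a] floor_divide_upper[of "v w" a]
    by (simp_all add: k_def algebra_simps)
  obtain y where "y \<noteq> 0" "v y = of_int k * v w"
  proof (cases "k \<ge> 0")
    case True
    then show ?thesis using that[of "w ^ nat k"] \<open>w \<noteq> 0\<close> v_power[of w "nat k"] by simp
  next
    case False
    then show ?thesis using that[of "inverse (w ^ nat (- k))"] \<open>w \<noteq> 0\<close> v_power[of w "nat (- k)"] v_inverse by simp
  qed
  then show ?thesis using that[of y] k \<open>v w < e\<close> by auto
qed

end

section \<open>A double root as two linear equations in the coefficients\<close>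

lemma order_ge_2_iff:
  fixes F :: "'a::idom poly"
  assumes "F \<noteq> 0"
  shows "order B F \<ge> 2 \<longleftrightarrow> poly F B = 0 \<and> poly (pderiv F) B = 0"
proof -
  have "order B F \<ge> 2 \<longleftrightarrow> [:- B, 1:] ^ 2 dvd F"
    using assms order_divides[of B 2 F] by simp
  also have "\<dots> \<longleftrightarrow> poly F B = 0 \<and> poly (pderiv F) B = 0"
  proof
    assume "[:- B, 1:] ^ 2 dvd F"
    then obtain G where "F = [:- B, 1:] ^ 2 * G" by (rule dvdE)
    then have "F = [:- B, 1:] * ([:- B, 1:] * G)" by (simp only: power2_eq_square mult.assoc)
    then show "poly F B = 0 \<and> poly (pderiv F) B = 0"
      by (simp only: pderiv_mult poly_add poly_mult) simp
  next
    assume F: "poly F B = 0 \<and> poly (pderiv F) B = 0"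
    then obtain G where G: "F = [:- B, 1:] * G" using poly_eq_0_iff_dvd by (metis dvdE)
    have "poly G B = 0" using F unfolding G pderiv_mult by (simp add: pderiv_pCons)
    then have "[:- B, 1:] dvd G" by (simp add: poly_eq_0_iff_dvd)
    then show "[:- B, 1:] ^ 2 dvd F" unfolding G power2_eq_square by (rule mult_dvd_mono[OF dvd_refl])
  qed
  finally show ?thesis .
qed

text \<open>Multiplying the derivative by \<open>B\<close> restores the exponent \<open>r\<close>,
  so both equations involve the same terms \<open>A_r B^r\<close>.\<close>

lemma poly_eq_sum_coeff:
  fixes F :: "'a::idom poly"
  shows "poly F B = (\<Sum>r\<le>degree F. coeff F r * B ^ r)"
    and "B * poly (pderiv F) B = (\<Sum>r\<le>degree F. of_nat r * (coeff F r * B ^ r))"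
proof -
  show "poly F B = (\<Sum>r\<le>degree F. coeff F r * B ^ r)" by (rule poly_altdef)
  have "pderiv F = pderiv (\<Sum>r\<le>degree F. monom (coeff F r) r)"
    by (simp only: poly_as_sum_of_monoms)
  also have "\<dots> = (\<Sum>r\<le>degree F. monom (of_nat r * coeff F r) (r - 1))"
    using higher_pderiv_sum[of 1 "\<lambda>r. monom (coeff F r) r" "{..degree F}"] by (simp add: pderiv_monom)
  finally have "pderiv F = (\<Sum>r\<le>degree F. monom (of_nat r * coeff F r) (r - 1))" .
  then have "B * poly (pderiv F) B = (\<Sum>r\<le>degree F. B * (of_nat r * coeff F r * B ^ (r - 1)))"
    by (simp add: poly_sum poly_monom sum_distrib_left)
  also have "\<dots> = (\<Sum>r\<le>degree F. of_nat r * (coeff F r * B ^ r))"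
  proof (rule sum.cong[OF refl])
    fix r show "B * (of_nat r * coeff F r * B ^ (r - 1)) = of_nat r * (coeff F r * B ^ r)"
      by (cases r) (simp_all add: algebra_simps)
  qed
  finally show "B * poly (pderiv F) B = (\<Sum>r\<le>degree F. of_nat r * (coeff F r * B ^ r))" .
qed

lemma closure_approachable_coordinates:
  fixes f :: "real ^ 'm::finite"
  assumes "\<And>e. e > 0 \<Longrightarrow> \<exists>g\<in>S. \<forall>m. \<bar>g $ m - f $ m\<bar> \<le> e"
  shows "f \<in> closure S"
  unfolding closure_approachable
proof (intro allI impI)
  fix e :: real assume "e > 0"
  \<comment> \<open>The distance is at most the sum of \<open>CARD('m)\<close> coordinate errors,
    here \<open>e / 2\<close>.\<close>
  define d where "d = e / (2 * real CARD('m))"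
  have "d > 0" using \<open>e > 0\<close> by (simp add: d_def)
  from assms[OF this] obtain g where g: "g \<in> S" "\<And>m. \<bar>g $ m - f $ m\<bar> \<le> d" by blast
  have "dist g f \<le> (\<Sum>m\<in>UNIV. \<bar>(g - f) $ m\<bar>)" unfolding dist_norm by (rule norm_le_l1_cart)
  also have "\<dots> \<le> (\<Sum>m\<in>(UNIV :: 'm set). d)" using g(2) by (intro sum_mono) simp
  also have "\<dots> < e" using \<open>e > 0\<close> by (simp add: d_def)
  finally show "\<exists>y\<in>S. dist y f < e" using g(1) by blast
qed

lemma closed_double_min_space: "closed (double_min_space c)"
  unfolding Union_cells[symmetric]
  by (intro closed_Union finite_cells ballI polyhedron_imp_closed cells_polyhedron)

section \<open>Double roots force repeated minima\<close>

locale tropical_setup = valued_field v T p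
  for v :: "'k::alg_closed_field \<Rightarrow> real" and T and p +
  fixes n :: nat and idx :: "nat \<Rightarrow> 'm::finite"
  assumes idx: "bij_betw idx {0..n} UNIV" and n: "n \<ge> 1"
begin

definition residue :: "'m \<Rightarrow> nat" where
  "residue m = inv_into {0..n} idx m mod p"

lemma residue_idx: "r \<le> n \<Longrightarrow> residue (idx r) = r mod p"
  using idx unfolding residue_def bij_betw_def by simp

lemma idx_inj: "r \<le> n \<Longrightarrow> t \<le> n \<Longrightarrow> idx r = idx t \<longleftrightarrow> r = t"
  using idx unfolding bij_betw_def inj_on_def by auto

lemma idx_surj: obtains r where "r \<le> n" "m = idx r"
proof -
  have "m \<in> idx ` {0..n}" using idx unfolding bij_betw_def by simp
  then show ?thesis using that by auto
qed

lemma all_idx: "(\<forall>m. P m) \<longleftrightarrow> (\<forall>r\<le>n. P (idx r))"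
  using idx_surj by metis

lemma double_root_in_double_min_space:
  assumes "tropical_double_root_0 v n idx f"
  shows "f \<in> double_min_space residue"
proof -
  obtain F :: "'k poly" and B where F: "degree F = n" "\<And>r. r \<le> n \<Longrightarrow> coeff F r \<noteq> 0"
      "\<And>r. r \<le> n \<Longrightarrow> v (coeff F r) = f $ idx r" and B: "B \<noteq> 0" "v B = 0" "order B F \<ge> 2"
    using assms unfolding tropical_double_root_0_def by auto
  \<comment> \<open>Absorbing the powers of \<open>B\<close> moves the root to 1; since
    \<open>v B = 0\<close>, the values stay those of \<open>f\<close>.\<close>
  define x where "x r = coeff F r * B ^ r" for r
  have x: "x r \<noteq> 0" "v (x r) = f $ idx r" if "r \<le> n" for r
    using F(2,3)[OF that] B v_mult[of "coeff F r" "B ^ r"] v_power[of B r] by (auto simp: x_def)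
  have "F \<noteq> 0" using F(2)[of 0] by auto
  then have "poly F B = 0" "poly (pderiv F) B = 0" using B(3) order_ge_2_iff by blast+
  then have sum0: "(\<Sum>r\<le>n. x r) = 0" and sum1: "(\<Sum>r\<le>n. of_nat r * x r) = 0"
    using poly_eq_sum_coeff[where F = F and B = B] F(1) by (auto simp: x_def)
  have diff0: "(\<Sum>r\<le>n. diff r s * x r) = 0" for s
    using sum0 sum1 by (simp add: diff_def left_diff_distrib sum_subtractf flip: sum_distrib_left)
  have "twice_min {m. residue m \<noteq> s} f" for s
  proof -
    define S where "S = {r. r \<le> n \<and> r mod p \<noteq> s}"
    \<comment> \<open>For \<open>s < p\<close> the weights kill exactly the class of
      \<open>s\<close>. For \<open>s \<ge> p\<close> no residue equals \<open>s\<close>, nothing is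
      removed, and the unweighted sum is the right relation.\<close>
    define y where "y r = (if s < p then diff r s * x r else x r)" for r
    have fin: "finite S" by (simp add: S_def)
    \<comment> \<open>The exponents 0 and 1 both occur, as \<open>n \<ge> 1\<close>, and at most one
      of them has residue \<open>s\<close>.\<close>
    have "0 mod p \<noteq> 1 mod p" using prime_gt_1_nat[OF p] by simp
    then have "S \<noteq> {}" using n unfolding S_def by (metis (mono_tags, lifting) empty_iff le0 mem_Collect_eq)
    have unit: "\<not> [r = s] (mod p)" if "r \<in> S" "s < p" for r
      using that by (simp add: S_def cong_def)
    have y: "y r \<noteq> 0" "v (y r) = f $ idx r" if "r \<in> S" for r
      using x[of r] diff_unit[OF unit[OF that]] v_diff_mult[OF unit[OF that]] that by (auto simp: y_def S_def)
    have "sum y S = (\<Sum>r\<le>n. y r)"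
    proof (rule sum.mono_neutral_left)
      show "\<forall>r\<in>{..n} - S. y r = 0"
      proof
        fix r assume "r \<in> {..n} - S"
        then have "r mod p = s" by (simp add: S_def)
        then have "s < p" "[r = s] (mod p)" using prime_gt_0_nat[OF p] by (auto simp: cong_def)
        then show "y r = 0" using diff_cong by (simp add: y_def)
      qed
    qed (auto simp: S_def)
    also have "\<dots> = 0" using diff0[of s] sum0 unfolding y_def by (cases "s < p") simp_all
    finally have sum_y: "sum y S = 0" .
    obtain i j where ij: "i \<in> S" "j \<in> S" "i \<noteq> j"
        "\<And>r. r \<in> S \<Longrightarrow> v (y i) \<le> v (y r) \<and> v (y j) \<le> v (y r)"
      using sum_zero_twice_min[OF fin \<open>S \<noteq> {}\<close> _ sum_y] y(1) by blast
    have "f $ idx i \<le> f $ m \<and> f $ idx j \<le> f $ m" if "residue m \<noteq> s" for m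
    proof -
      obtain r where "r \<le> n" "m = idx r" by (rule idx_surj)
      then have "r \<in> S" using that residue_idx by (simp add: S_def)
      then show ?thesis using ij y(2) \<open>m = idx r\<close> by simp
    qed
    moreover have "idx i \<noteq> idx j" "residue (idx i) \<noteq> s" "residue (idx j) \<noteq> s"
      using ij(1-3) idx_inj residue_idx by (auto simp: S_def)
    ultimately show ?thesis unfolding twice_min_def by blast
  qed
  then show ?thesis by (simp add: double_min_space_def)
qed

lemma H_space_subset: "H_space v T n idx \<subseteq> double_min_space residue"
  unfolding H_space_def using double_root_in_double_min_space
  by (intro closure_minimal closed_double_min_space) auto

section \<open>Lifting generic points and passing to the closure\<close>

abbreviation realisable :: "(real ^ 'm) set" where
  "realisable \<equiv> {f. (\<forall>r\<in>{0..n}. f $ idx r \<in> T) \<and> tropical_double_root_0 v n idx f}"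

text \<open>The double root is placed at 1. The equation weighted by \<open>r - s\<close> differs
  from the derivative only by a multiple of the coefficient sum, so \<open>s\<close> may be chosen
  to eliminate a convenient residue class.\<close>

lemma realisableI:
  assumes A: "\<And>r. r \<le> n \<Longrightarrow> A r \<noteq> 0" "\<And>r. r \<le> n \<Longrightarrow> v (A r) = f $ idx r"
    and sum: "(\<Sum>r\<le>n. A r) = 0" "(\<Sum>r\<le>n. diff r s * A r) = 0"
  shows "f \<in> realisable"
proof -
  define F where "F = (\<Sum>r\<le>n. monom (A r) r)"
  have coeff: "coeff F r = (if r \<le> n then A r else 0)" for r
    unfolding F_def by (simp add: coeff_sum)
  have deg: "degree F = n"
  proof (rule antisym)
    show "degree F \<le> n" by (rule degree_le) (simp add: coeff)
    show "n \<le> degree F" using A(1)[of n] by (intro le_degree) (simp add: coeff)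
  qed
  have "F \<noteq> 0" using A(1)[of 0] coeff[of 0] by auto
  have "(\<Sum>r\<le>n. of_nat r * A r) = (\<Sum>r\<le>n. diff r s * A r) + of_nat s * (\<Sum>r\<le>n. A r)"
    by (simp add: diff_def left_diff_distrib sum_subtractf sum_distrib_left)
  then have "poly F 1 = 0" "poly (pderiv F) 1 = 0"
    using poly_eq_sum_coeff[where F = F and B = 1] sum by (simp_all add: deg coeff)
  then have "order 1 F \<ge> 2" using order_ge_2_iff[OF \<open>F \<noteq> 0\<close>] by blast
  then have "tropical_double_root_0 v n idx f"
    unfolding tropical_double_root_0_def using A by (intro exI[of _ F] conjI exI[of _ 1]) (auto simp: deg coeff)
  moreover have "v (A r) \<in> T" if "r \<le> n" for r
    using val A(1)[OF that] unfolding valuation_into_def by blast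
  ultimately show ?thesis using A(2) by auto
qed

text \<open>All coefficients but those at \<open>i\<close> and \<open>k\<close> are prescribed. The
  equation weighted by \<open>r - i\<close> does not see \<open>i\<close> and determines the one at
  \<open>k\<close>; the plain sum then determines the one at \<open>i\<close>.\<close>

lemma realisable_triple:
  assumes ijk: "i \<le> n" "j \<le> n" "k \<le> n" "\<not> [i = j] (mod p)" "\<not> [i = k] (mod p)" "\<not> [j = k] (mod p)"
    and eq: "f $ idx j = f $ idx i" "f $ idx k = f $ idx i"
    and less: "\<And>r. r \<le> n \<Longrightarrow> r \<notin> {i, j, k} \<Longrightarrow> f $ idx i < f $ idx r"
    and val: "\<And>r. r \<le> n \<Longrightarrow> \<exists>y. y \<noteq> 0 \<and> v y = f $ idx r"
  shows "f \<in> realisable"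
proof -
  obtain Y where Y: "\<And>r. r \<le> n \<Longrightarrow> Y r \<noteq> 0 \<and> v (Y r) = f $ idx r" using val by metis
  have ne: "i \<noteq> j" "i \<noteq> k" "j \<noteq> k" using ijk by auto
  define S where "S = {..n} - {i, j, k}"
  have split: "(\<Sum>r\<le>n. g r) = g i + g j + g k + sum g S" for g :: "nat \<Rightarrow> 'k"
  proof -
    have "(\<Sum>r\<le>n. g r) = sum g {i, j, k} + sum g S"
      unfolding S_def using ijk by (subst sum.subset_diff[of "{i, j, k}"]) (auto simp: add.commute)
    then show ?thesis using ne by (simp add: add.assoc)
  qed
  have aboveS: "above (f $ idx i) (\<Sum>r\<in>S. diff r s * Y r)" for s
  proof (intro above_sum above_diff_mult)
    fix r assume "r \<in> S"
    then show "above (f $ idx i) (Y r)" using Y[of r] less[of r] by (simp add: S_def above_def)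
  qed
  have sym: "\<not> [j = i] (mod p)" "\<not> [k = i] (mod p)" "\<not> [k = j] (mod p)" using ijk cong_sym by blast+
  have Yj: "Y j \<noteq> 0" "v (Y j) = f $ idx i" using Y[of j] ijk eq by auto
  obtain y where y: "y \<noteq> 0" "v y = f $ idx i" "diff j i * Y j + diff k i * y + (\<Sum>r\<in>S. diff r i * Y r) = 0"
    using solve_two_terms[OF diff_unit[OF sym(1)] diff_unit[OF sym(2)] Yj(1), of "\<Sum>r\<in>S. diff r i * Y r"]
      aboveS[of i] Yj(2) by metis
  define z where "z = - (Y j + y + sum Y S)"
  define A where "A = Y(k := y, i := z)"
  have AS: "A r = Y r" if "r \<in> S" for r using that by (auto simp: A_def S_def)
  have Aijk: "A i = z" "A j = Y j" "A k = y" using ne by (auto simp: A_def)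
  have sum0: "(\<Sum>r\<le>n. A r) = 0" unfolding split Aijk using AS by (simp add: z_def)
  have sum1: "(\<Sum>r\<le>n. diff r i * A r) = 0" unfolding split Aijk using AS y(3) by (simp add: diff_def)
  \<comment> \<open>The definition of \<open>z\<close> does not reveal its value, because
    \<open>Y j + y\<close> may cancel. Changing the weight from \<open>r - i\<close> to
    \<open>r - j\<close> removes the term at \<open>j\<close>, and then \<open>diff k j * y\<close>
    dominates.\<close>
  have "(\<Sum>r\<le>n. diff r j * A r) = (\<Sum>r\<le>n. diff r i * A r) + diff i j * (\<Sum>r\<le>n. A r)"
    by (simp add: sum_distrib_left flip: sum.distrib) (simp add: diff_def algebra_simps)
  also have "\<dots> = 0" by (simp add: sum0 sum1)
  finally have "diff i j * z + diff j j * Y j + diff k j * y + (\<Sum>r\<in>S. diff r j * A r) = 0"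
    unfolding split Aijk .
  moreover have "(\<Sum>r\<in>S. diff r j * A r) = (\<Sum>r\<in>S. diff r j * Y r)" using AS by simp
  moreover have "diff j j = 0" by (simp add: diff_def)
  ultimately have "diff i j * z + diff k j * y + (\<Sum>r\<in>S. diff r j * Y r) = 0" by simp
  then have z_eq: "diff i j * z = - (diff k j * y + (\<Sum>r\<in>S. diff r j * Y r))"
    by (simp only: eq_neg_iff_add_eq_0 add.assoc)
  have ky: "diff k j * y \<noteq> 0" "v (diff k j * y) = f $ idx i"
    using y v_diff_mult[OF sym(3)] diff_unit[OF sym(3)] by auto
  have iz: "diff i j * z \<noteq> 0" "v (diff i j * z) = f $ idx i"
    unfolding z_eq using v_add_above[OF ky(1)] aboveS[of j] ky(2) by (auto simp del: minus_add_distrib)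
  then have z: "z \<noteq> 0" "v z = f $ idx i" using v_diff_mult[OF ijk(4)] by auto
  show ?thesis
  proof (rule realisableI[OF _ _ sum0 sum1])
    fix r assume "r \<le> n"
    then show "A r \<noteq> 0" "v (A r) = f $ idx r" using Y[of r] y z eq by (auto simp: A_def)
  qed
qed

text \<open>The two equations decouple. The one weighted by \<open>r - i\<close> involves only
  exponents not congruent to \<open>i\<close> and is solved at \<open>l\<close>; the plain sum is
  then solved at \<open>j\<close>, which the weighted equation does not see.\<close>

lemma realisable_pairs:
  assumes ijkl: "i \<le> n" "j \<le> n" "k \<le> n" "l \<le> n" "i \<noteq> j" "[j = i] (mod p)"
      "\<not> [k = i] (mod p)" "\<not> [l = i] (mod p)" "k \<noteq> l"
    and eq: "f $ idx j = f $ idx i" "f $ idx l = f $ idx k"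
    and less: "\<And>r. r \<le> n \<Longrightarrow> r \<notin> {i, j} \<Longrightarrow> f $ idx i < f $ idx r"
      "\<And>r. r \<le> n \<Longrightarrow> \<not> [r = i] (mod p) \<Longrightarrow> r \<notin> {k, l} \<Longrightarrow> f $ idx k < f $ idx r"
    and val: "\<And>r. r \<le> n \<Longrightarrow> \<exists>y. y \<noteq> 0 \<and> v y = f $ idx r"
  shows "f \<in> realisable"
proof -
  obtain Y where Y: "\<And>r. r \<le> n \<Longrightarrow> Y r \<noteq> 0 \<and> v (Y r) = f $ idx r" using val by metis
  have split: "(\<Sum>r\<le>n. g r) = g a + g b + sum g ({..n} - {a, b})" if "a \<le> n" "b \<le> n" "a \<noteq> b"
    for g :: "nat \<Rightarrow> 'k" and a b
  proof -
    have "(\<Sum>r\<le>n. g r) = sum g {a, b} + sum g ({..n} - {a, b})"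
      using that by (subst sum.subset_diff[of "{a, b}"]) (auto simp: add.commute)
    then show ?thesis using that by (simp add: add.assoc)
  qed
  have Yk: "Y k \<noteq> 0" "v (Y k) = f $ idx k" using Y ijkl by auto
  have "above (v (Y k)) (\<Sum>r\<in>{..n} - {k, l}. diff r i * Y r)"
  proof (intro above_sum)
    fix r assume r: "r \<in> {..n} - {k, l}"
    show "above (v (Y k)) (diff r i * Y r)"
    proof (cases "[r = i] (mod p)")
      case True
      then show ?thesis by (simp add: diff_cong above_def)
    next
      case False
      then show ?thesis using less(2)[of r] Y[of r] r Yk(2) by (intro above_diff_mult) (simp add: above_def)
    qed
  qed
  from solve_two_terms[OF diff_unit[OF ijkl(7)] diff_unit[OF ijkl(8)] Yk(1) this]
  obtain y where y: "y \<noteq> 0" "v y = v (Y k)"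
      "diff k i * Y k + diff l i * y + (\<Sum>r\<in>{..n} - {k, l}. diff r i * Y r) = 0"
    by blast
  define A0 where "A0 = Y(l := y)"
  have A0: "A0 r \<noteq> 0" "v (A0 r) = f $ idx r" if "r \<le> n" for r
    using that Y[OF that] y Yk(2) eq(2) by (auto simp: A0_def)
  have "above (v (A0 i)) (sum A0 ({..n} - {i, j}))"
    using A0 less(1) ijkl(1) by (intro above_sum) (auto simp: above_def)
  from solve_two_terms[OF one_neq_zero v_1 one_neq_zero v_1 A0(1)[OF ijkl(1)] this]
  obtain z where z: "z \<noteq> 0" "v z = v (A0 i)" "1 * A0 i + 1 * z + sum A0 ({..n} - {i, j}) = 0"
    by blast
  define A where "A = A0(j := z)"
  have sum0: "(\<Sum>r\<le>n. A r) = 0"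
    using z(3) ijkl(5) unfolding split[OF ijkl(1,2,5)] by (simp add: A_def)
  have "(\<Sum>r\<le>n. diff r i * A r) = (\<Sum>r\<le>n. diff r i * A0 r)"
    using diff_cong[OF ijkl(6)] by (intro sum.cong) (auto simp: A_def)
  also have "\<dots> = 0"
    using y(3) ijkl(9) unfolding split[OF ijkl(3,4,9)] by (simp add: A0_def)
  finally have sum1: "(\<Sum>r\<le>n. diff r i * A r) = 0" .
  show ?thesis
  proof (rule realisableI[OF _ _ sum0 sum1])
    fix r assume "r \<le> n"
    then show "A r \<noteq> 0" "v (A r) = f $ idx r" using A0 z eq ijkl by (auto simp: A_def)
  qed
qed

lemma triple_cell_H_space:
  assumes ijk: "i \<le> n" "j \<le> n" "k \<le> n" "\<not> [i = j] (mod p)" "\<not> [i = k] (mod p)" "\<not> [j = k] (mod p)"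
    and f: "f \<in> triple_cell (idx i) (idx j) (idx k)"
  shows "f \<in> H_space v T n idx"
  unfolding H_space_def
proof (rule closure_approachable_coordinates)
  fix d :: real assume "d > 0"
  \<comment> \<open>Coordinates move by at most \<open>e\<close> to become generic and by less than
    \<open>e / 2\<close> to reach the value group, in total less than \<open>d\<close>.\<close>
  define e where "e = d / 2"
  have e: "e > 0" "e / 2 > 0" using \<open>d > 0\<close> by (auto simp: e_def)
  let ?I = "{idx i, idx j, idx k}"
  define t where "t m = f $ m + (if m \<in> ?I then 0 else e)" for m
  have "\<forall>m. \<exists>y. y \<noteq> 0 \<and> \<bar>v y - t m\<bar> < e / 2"
    using value_dense[OF e(2)] by blast
  then obtain y where y: "\<And>m. y m \<noteq> 0 \<and> \<bar>v (y m) - t m\<bar> < e / 2"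
    by metis
  \<comment> \<open>One field element serves all three tied coordinates, so the approximation keeps
    the ties exactly.\<close>
  define g :: "real ^ 'm" where "g = (\<chi> m. v (y (if m \<in> ?I then idx i else m)))"
  have f': "f $ idx j = f $ idx i" "f $ idx k = f $ idx i" "\<And>m. f $ idx i \<le> f $ m"
    using f unfolding triple_cell_def by auto
  have close: "\<bar>g $ m - t m\<bar> < e / 2" for m
    using y[of m] y[of "idx i"] f' by (auto simp: g_def t_def)
  have "g \<in> realisable"
  proof (rule realisable_triple[OF ijk])
    fix r assume r: "r \<le> n" "r \<notin> {i, j, k}"
    then have "t (idx r) = f $ idx r + e" using idx_inj ijk(1-3) by (auto simp: t_def)
    moreover have "t (idx i) = f $ idx i" by (simp add: t_def)
    ultimately show "g $ idx i < g $ idx r"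
      using close[of "idx r"] close[of "idx i"] f'(3)[of "idx r"] by linarith
  next
    fix r show "\<exists>x. x \<noteq> 0 \<and> v x = g $ idx r" using y by (auto simp: g_def)
  qed (auto simp: g_def)
  moreover have "\<bar>g $ m - f $ m\<bar> \<le> d" for m
  proof -
    have "\<bar>t m - f $ m\<bar> \<le> e" using e by (simp add: t_def)
    then show ?thesis using close[of m] e unfolding e_def by linarith
  qed
  ultimately show "\<exists>g\<in>realisable. \<forall>m. \<bar>g $ m - f $ m\<bar> \<le> d" by blast
qed

lemma nested_H_space:
  assumes ijkl: "i \<le> n" "j \<le> n" "k \<le> n" "l \<le> n" "i \<noteq> j" "[j = i] (mod p)"
      "\<not> [k = i] (mod p)" "\<not> [l = i] (mod p)" "k \<noteq> l"
    and f: "f $ idx j = f $ idx i" "f $ idx l = f $ idx k" "\<And>m. f $ idx i \<le> f $ m"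
      "\<And>m. residue m \<noteq> residue (idx i) \<Longrightarrow> f $ idx k \<le> f $ m"
  shows "f \<in> H_space v T n idx"
  unfolding H_space_def
proof (rule closure_approachable_coordinates)
  fix d :: real assume "d > 0"
  define e where "e = d / 3"
  have e: "e > 0" "e / 2 > 0" using \<open>d > 0\<close> by (auto simp: e_def)
  have ne: "{i, j} \<inter> {k, l} = {}" using ijkl by auto
  have neq: "idx k \<notin> {idx i, idx j}" "idx l \<notin> {idx i, idx j}" using ne idx_inj ijkl(1-4) by auto
  \<comment> \<open>Raising the second pair by \<open>e\<close> separates it from the first even if
    they were level; raising the rest by \<open>2 * e\<close> makes both minima strict. With the
    approximation error this stays below \<open>d = 3 * e\<close>.\<close>
  define t where "t m = f $ m + (if m \<in> {idx i, idx j} then 0 else if m \<in> {idx k, idx l} then e else 2 * e)" for m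
  have "\<forall>m. \<exists>y. y \<noteq> 0 \<and> \<bar>v y - t m\<bar> < e / 2"
    using value_dense[OF e(2)] by blast
  then obtain y where y: "\<And>m. y m \<noteq> 0 \<and> \<bar>v (y m) - t m\<bar> < e / 2"
    by metis
  define g :: "real ^ 'm" where
    "g = (\<chi> m. v (y (if m \<in> {idx i, idx j} then idx i else if m \<in> {idx k, idx l} then idx k else m)))"
  have close: "\<bar>g $ m - t m\<bar> < e / 2" for m
    using y[of m] y[of "idx i"] y[of "idx k"] f neq by (auto simp: g_def t_def)
  have ti: "t (idx i) = f $ idx i" and tk: "t (idx k) = f $ idx k + e"
    using neq by (auto simp: t_def)
  have "g \<in> realisable"
  proof (rule realisable_pairs[OF ijkl])
    fix r assume r: "r \<le> n" "r \<notin> {i, j}"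
    then have "t (idx r) \<ge> f $ idx r + e" using idx_inj ijkl(1-4) e by (auto simp: t_def)
    then show "g $ idx i < g $ idx r"
      using close[of "idx r"] close[of "idx i"] f(3)[of "idx r"] ti by linarith
  next
    fix r assume r: "r \<le> n" "\<not> [r = i] (mod p)" "r \<notin> {k, l}"
    then have "r \<notin> {i, j}" using ijkl(6) by auto
    then have "t (idx r) = f $ idx r + 2 * e" using r idx_inj ijkl(1-4) by (auto simp: t_def)
    moreover have "f $ idx k \<le> f $ idx r"
      using r ijkl(1) by (intro f(4)) (simp add: residue_idx cong_def)
    ultimately show "g $ idx k < g $ idx r"
      using close[of "idx r"] close[of "idx k"] tk by linarith
  next
    fix r show "\<exists>x. x \<noteq> 0 \<and> v x = g $ idx r" using y by (auto simp: g_def)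
  qed (use neq in \<open>auto simp: g_def\<close>)
  moreover have "\<bar>g $ m - f $ m\<bar> \<le> d" for m
  proof -
    have "\<bar>t m - f $ m\<bar> \<le> 2 * e" using e by (simp add: t_def)
    then show ?thesis using close[of m] e unfolding e_def by linarith
  qed
  ultimately show "\<exists>g\<in>realisable. \<forall>m. \<bar>g $ m - f $ m\<bar> \<le> d" by blast
qed

lemma cong_iff_residue: "r \<le> n \<Longrightarrow> t \<le> n \<Longrightarrow> [r = t] (mod p) \<longleftrightarrow> residue (idx r) = residue (idx t)"
  by (simp add: cong_def residue_idx)

text \<open>A cone of two pairs is treated according to which pair is lower. If \<open>k\<close>,
  \<open>l\<close> are strictly lower, then \<open>k\<close> must be exempt from comparison with
  \<open>i\<close>, so \<open>k\<close>, \<open>l\<close> share a colour and the pairs may exchange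
  roles.\<close>

lemma cells_subset_H_space:
  assumes "\<sigma> \<in> cells residue" shows "\<sigma> \<subseteq> H_space v T n idx"
proof
  fix f assume f: "f \<in> \<sigma>"
  from assms show "f \<in> H_space v T n idx"
  proof (cases rule: cells_cases)
    case (triple i' j' k')
    obtain i j k where ijk: "i \<le> n" "j \<le> n" "k \<le> n" "i' = idx i" "j' = idx j" "k' = idx k"
      using idx_surj by metis
    then show ?thesis
      using triple f unfolding rainbow_def
      by (intro triple_cell_H_space[of i j k]) (auto simp: cong_iff_residue)
  next
    case (pair i' j' k' l')
    obtain i j k l where ijkl: "i \<le> n" "j \<le> n" "k \<le> n" "l \<le> n"
      "i' = idx i" "j' = idx j" "k' = idx k" "l' = idx l"
      using idx_surj by metis
    have pr: "i \<noteq> j" "k \<noteq> l" "residue (idx j) = residue (idx i)" "residue (idx k) \<noteq> residue (idx i)"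
      "residue (idx l) \<noteq> residue (idx i)"
      using pair(2) ijkl(5-) unfolding paired_def by auto
    have ff: "f $ idx j = f $ idx i" "f $ idx l = f $ idx k"
      "\<And>m. \<not> (residue m = residue (idx k) \<and> residue m = residue (idx l)) \<Longrightarrow> f $ idx i \<le> f $ m"
      "\<And>m. residue m \<noteq> residue (idx i) \<Longrightarrow> f $ idx k \<le> f $ m"
      using f unfolding pair(1) pair_cell_def ijkl(5-) by auto
    show ?thesis
    proof (cases "f $ idx i \<le> f $ idx k")
      case True
      have "f $ idx i \<le> f $ m" for m
        using True ff(3)[of m] ff(4)[of m] pr by fastforce
      then show ?thesis
        using ijkl(1-4) pr ff by (intro nested_H_space[of i j k l]) (auto simp: cong_iff_residue)
    next
      case False
      then have kl: "residue (idx l) = residue (idx k)" using ff(3)[of "idx k"] by metis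
      have "f $ idx k \<le> f $ m" for m
        using False ff(3)[of m] ff(4)[of m] pr by fastforce
      then show ?thesis
        using ijkl(1-4) pr ff kl by (intro nested_H_space[of k l i j]) (auto simp: cong_iff_residue)
    qed
  qed
qed

lemma H_space_eq: "H_space v T n idx = double_min_space residue"
  using H_space_subset cells_subset_H_space Union_cells by blast

section \<open>The cones in terms of attained minima\<close>

lemma min_attained_all:
  "min_attained_at (\<lambda>t. f $ idx t) {0..n} r \<longleftrightarrow> r \<le> n \<and> (\<forall>m. f $ idx r \<le> f $ m)"
  unfolding min_attained_at_def all_idx by auto

lemma min_attained_incongruent:
  assumes "i \<le> n"
  shows "min_attained_at (\<lambda>t. f $ idx t) {t \<in> {0..n}. \<not> [t = i] (mod p)} r \<longleftrightarrow>
    r \<le> n \<and> residue (idx r) \<noteq> residue (idx i) \<and>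
    (\<forall>m. residue m \<noteq> residue (idx i) \<longrightarrow> f $ idx r \<le> f $ m)"
  unfolding min_attained_at_def all_idx using assms cong_iff_residue by auto

lemma triple_min_set_eq:
  assumes "i \<le> n" "j \<le> n" "k \<le> n"
  shows "triple_min_set n idx i j k = triple_cell (idx i) (idx j) (idx k)"
  unfolding triple_min_set_def triple_cell_def
  using assms by (auto simp: min_attained_all intro: antisym)

lemma nested_min_set_iff:
  assumes "i \<le> n" "j \<le> n" "k \<le> n" "l \<le> n"
    "residue (idx k) \<noteq> residue (idx i)" "residue (idx l) \<noteq> residue (idx i)"
  shows "f \<in> nested_min_set p n idx i j k l \<longleftrightarrow>
    f $ idx i = f $ idx j \<and> f $ idx k = f $ idx l \<and> (\<forall>m. f $ idx i \<le> f $ m) \<and>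
    (\<forall>m. residue m \<noteq> residue (idx i) \<longrightarrow> f $ idx k \<le> f $ m)"
  unfolding nested_min_set_def min_attained_all min_attained_incongruent[OF assms(1)]
  using assms by (auto intro: antisym)

lemma nested_min_set_eq:
  assumes "i \<le> n" "j \<le> n" "k \<le> n" "l \<le> n"
    "residue (idx k) \<noteq> residue (idx i)" "residue (idx l) \<noteq> residue (idx i)"
    "residue (idx k) \<noteq> residue (idx l)"
  shows "nested_min_set p n idx i j k l = pair_cell residue (idx i) (idx j) (idx k) (idx l)"
  using nested_min_set_iff[OF assms(1-6)] assms(7) unfolding pair_cell_def by auto

text \<open>The lower of the values at \<open>i\<close> and \<open>k\<close> is the overall minimum:
  each bounds all colours but that of the other pair, and there the other value takes over.\<close>

lemma nested_min_set_Un_eq: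
  assumes le: "i \<le> n" "j \<le> n" "k \<le> n" "l \<le> n"
    and res: "residue (idx i) = residue (idx j)" "residue (idx k) \<noteq> residue (idx i)"
    "residue (idx k) = residue (idx l)"
  shows "nested_min_set p n idx i j k l \<union> nested_min_set p n idx k l i j =
    pair_cell residue (idx i) (idx j) (idx k) (idx l)"
proof (intro set_eqI)
  fix f
  have 1: "residue (idx l) \<noteq> residue (idx i)" "residue (idx i) \<noteq> residue (idx k)" "residue (idx j) \<noteq> residue (idx k)"
    using res by auto
  have "f \<in> pair_cell residue (idx i) (idx j) (idx k) (idx l) \<longleftrightarrow>
     f $ idx i = f $ idx j \<and> f $ idx k = f $ idx l \<and>
     (\<forall>m. residue m \<noteq> residue (idx k) \<longrightarrow> f $ idx i \<le> f $ m) \<and>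
     (\<forall>m. residue m \<noteq> residue (idx i) \<longrightarrow> f $ idx k \<le> f $ m)" (is "_ \<longleftrightarrow> ?R")
    unfolding pair_cell_def using res by auto
  moreover have "?R \<longleftrightarrow> f \<in> nested_min_set p n idx i j k l \<or> f \<in> nested_min_set p n idx k l i j"
    unfolding nested_min_set_iff[OF le res(2) 1(1)] nested_min_set_iff[OF le(3,4,1,2) 1(2,3)]
  proof
    assume R: ?R
    show "(f $ idx i = f $ idx j \<and> f $ idx k = f $ idx l \<and> (\<forall>m. f $ idx i \<le> f $ m) \<and>
        (\<forall>m. residue m \<noteq> residue (idx i) \<longrightarrow> f $ idx k \<le> f $ m)) \<or>
      (f $ idx k = f $ idx l \<and> f $ idx i = f $ idx j \<and> (\<forall>m. f $ idx k \<le> f $ m) \<and>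
        (\<forall>m. residue m \<noteq> residue (idx k) \<longrightarrow> f $ idx i \<le> f $ m))"
    proof (cases "f $ idx i \<le> f $ idx k")
      case True
      have "f $ idx i \<le> f $ m" for m
      proof (cases "residue m = residue (idx k)")
        case m: True
        then have "f $ idx k \<le> f $ m" using R 1(2) by metis
        then show ?thesis using True by linarith
      qed (use R in blast)
      then show ?thesis using R by blast
    next
      case False
      have "f $ idx k \<le> f $ m" for m
      proof (cases "residue m = residue (idx i)")
        case m: True
        then have "f $ idx i \<le> f $ m" using R 1(2) by metis
        then show ?thesis using False by linarith
      qed (use R in blast)
      then show ?thesis using R by blast
    qed
  qed blast
  ultimately show "f \<in> nested_min_set p n idx i j k l \<union> nested_min_set p n idx k l i j \<longleftrightarrow>
    f \<in> pair_cell residue (idx i) (idx j) (idx k) (idx l)" by blast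
qed

text \<open>The cones are closed, so the closures in the three types change nothing; type II and
  type III are the cases of different and of equal colours of \<open>k\<close>,
  \<open>l\<close>.\<close>

lemma types_eq_cells:
  "type_I_cells p n idx \<union> type_II_cells p n idx \<union> type_III_cells p n idx = cells residue"
proof -
  have closure_cell: "closure \<sigma> = \<sigma>" if "\<sigma> \<in> cells residue" for \<sigma>
    by (rule closure_closed[OF polyhedron_imp_closed[OF cells_polyhedron[OF that]]])
  show ?thesis
  proof (intro equalityI subsetI)
    fix \<sigma> assume "\<sigma> \<in> type_I_cells p n idx \<union> type_II_cells p n idx \<union> type_III_cells p n idx"
    then consider "\<sigma> \<in> type_I_cells p n idx" | "\<sigma> \<in> type_II_cells p n idx" | "\<sigma> \<in> type_III_cells p n idx" by blast
    then show "\<sigma> \<in> cells residue"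
    proof cases
      case 1
      then obtain i j k where \<sigma>: "\<sigma> = closure (triple_min_set n idx i j k)" and le: "i \<le> n" "j \<le> n" "k \<le> n"
        and c: "\<not> [i = j] (mod p)" "\<not> [i = k] (mod p)" "\<not> [j = k] (mod p)"
        unfolding type_I_cells_def by auto
      have "rainbow residue (idx i) (idx j) (idx k)" using c le by (simp add: rainbow_def cong_iff_residue)
      then have "triple_cell (idx i) (idx j) (idx k) \<in> cells residue" unfolding cells_def by blast
      then show ?thesis unfolding \<sigma> triple_min_set_eq[OF le] using closure_cell by simp
    next
      case 2
      then obtain i j k l where \<sigma>: "\<sigma> = closure (nested_min_set p n idx i j k l)"
        and le: "i \<le> n" "j \<le> n" "k \<le> n" "l \<le> n" and ne: "i \<noteq> j"
        and c: "[i = j] (mod p)" "\<not> [k = i] (mod p)" "\<not> [l = i] (mod p)" "\<not> [k = l] (mod p)"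
        unfolding type_II_cells_def by auto
      note c' = c[unfolded cong_iff_residue[OF le(1,2)] cong_iff_residue[OF le(3,1)]
          cong_iff_residue[OF le(4,1)] cong_iff_residue[OF le(3,4)]]
      have "paired residue (idx i) (idx j) (idx k) (idx l)" using c' ne le idx_inj by (auto simp: paired_def)
      then have "pair_cell residue (idx i) (idx j) (idx k) (idx l) \<in> cells residue" unfolding cells_def by blast
      then show ?thesis unfolding \<sigma> nested_min_set_eq[OF le c'(2-4)] using closure_cell by simp
    next
      case 3
      then obtain i j k l where
        \<sigma>: "\<sigma> = closure (nested_min_set p n idx i j k l \<union> nested_min_set p n idx k l i j)"
        and le: "i \<le> n" "j \<le> n" "k \<le> n" "l \<le> n" and ne: "i \<noteq> j" "k \<noteq> l"
        and c: "[i = j] (mod p)" "\<not> [k = i] (mod p)" "[k = l] (mod p)"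
        unfolding type_III_cells_def by auto
      note c' = c[unfolded cong_iff_residue[OF le(1,2)] cong_iff_residue[OF le(3,1)]
          cong_iff_residue[OF le(3,4)]]
      have "paired residue (idx i) (idx j) (idx k) (idx l)" using c' ne le idx_inj by (auto simp: paired_def)
      then have "pair_cell residue (idx i) (idx j) (idx k) (idx l) \<in> cells residue" unfolding cells_def by blast
      then show ?thesis unfolding \<sigma> nested_min_set_Un_eq[OF le c'] using closure_cell by simp
    qed
  next
    fix \<sigma> assume \<sigma>: "\<sigma> \<in> cells residue"
    then show "\<sigma> \<in> type_I_cells p n idx \<union> type_II_cells p n idx \<union> type_III_cells p n idx"
    proof (cases rule: cells_cases)
      case (triple i' j' k')
      obtain i j k where le: "i \<le> n" "j \<le> n" "k \<le> n" and ijk: "i' = idx i" "j' = idx j" "k' = idx k"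
        using idx_surj by metis
      have "\<sigma> = closure (triple_min_set n idx i j k)"
        using closure_cell[OF \<sigma>] triple_min_set_eq[OF le] triple(1) ijk by simp
      moreover have "{i, j, k} \<subseteq> {0..n} \<and> \<not> [i = j] (mod p) \<and> \<not> [i = k] (mod p) \<and> \<not> [j = k] (mod p)"
        using triple(2) le by (simp add: rainbow_def cong_iff_residue ijk)
      ultimately have "\<sigma> \<in> type_I_cells p n idx" unfolding type_I_cells_def by blast
      then show ?thesis by blast
    next
      case (pair i' j' k' l')
      obtain i j k l where le: "i \<le> n" "j \<le> n" "k \<le> n" "l \<le> n"
        and ijkl: "i' = idx i" "j' = idx j" "k' = idx k" "l' = idx l"
        using idx_surj by metis
      have pr: "i \<noteq> j" "residue (idx i) = residue (idx j)" "residue (idx k) \<noteq> residue (idx i)"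
        "residue (idx l) \<noteq> residue (idx i)" "k \<noteq> l"
        using pair(2) unfolding paired_def ijkl by auto
      show ?thesis
      proof (cases "residue (idx k) = residue (idx l)")
        case True
        have "\<sigma> = closure (nested_min_set p n idx i j k l \<union> nested_min_set p n idx k l i j)"
          using closure_cell[OF \<sigma>] nested_min_set_Un_eq[OF le pr(2,3) True] pair(1) ijkl by simp
        moreover have "{i, j, k, l} \<subseteq> {0..n} \<and> i \<noteq> j \<and> [i = j] (mod p) \<and> \<not> [k = i] (mod p) \<and> k \<noteq> l \<and> [k = l] (mod p)"
          using pr le True by (simp add: cong_iff_residue)
        ultimately have "\<sigma> \<in> type_III_cells p n idx" unfolding type_III_cells_def by blast
        then show ?thesis by blast
      next
        case False
        have "\<sigma> = closure (nested_min_set p n idx i j k l)"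
          using closure_cell[OF \<sigma>] nested_min_set_eq[OF le pr(3,4) False] pair(1) ijkl by simp
        moreover have "{i, j, k, l} \<subseteq> {0..n} \<and> i \<noteq> j \<and> [i = j] (mod p) \<and>
            \<not> [k = i] (mod p) \<and> \<not> [l = i] (mod p) \<and> \<not> [k = l] (mod p)"
          using pr le False by (simp add: cong_iff_residue)
        ultimately have "\<sigma> \<in> type_II_cells p n idx" unfolding type_II_cells_def by blast
        then show ?thesis by blast
      qed
    qed
  qed
qed

end

theorem mainTheorem5:
  fixes v :: "'k::alg_closed_field \<Rightarrow> real" and T :: "real set"
    and p n :: nat and idx :: "nat \<Rightarrow> 'm::finite"
  assumes "prime p" and "p > 2" and "n \<ge> 1"
    and "valuation_into v T" and "CHAR('k) = p"
    and "bij_betw idx {0..n} UNIV"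
  shows "\<exists>\<Sigma>. coarsest_fan_on (H_space v T n idx) \<Sigma> \<and>
           maximal_cells \<Sigma> =
             type_I_cells p n idx \<union> type_II_cells p n idx \<union> type_III_cells p n idx"
proof -
  interpret tropical_setup v T p n idx
    using assms by unfold_locales auto
  show ?thesis
    unfolding H_space_eq types_eq_cells
    using coarsest_fan_on_double_min_space maximal_cells_double_min_space by blast
qed

end
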